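(* The category $\mathbf{TBoole}$ of Boolean T-algebras and the category $\mathbf{TMaps}$ of Boolean T-maps are both dually equivalent to the category $\mathbf D$ of discrete spaces and continuous maps (and, thus, to the category $\mathbf{Set}$ of sets and functions).
   Context: Boolean algebras with $0=1$ are allowed. $\mathbf{2}=\{0,1\}$ is the two-element Boolean algebra; $\mathbf{Boole}(A,\mathbf 2)$ is the set of Boolean homomorphisms $A\to\mathbf 2$. $\mathbf{Caba}$ is the category of complete atomic Boolean algebras and complete Boolean homomorphisms; $\mathrm{At}(B)$ is the set of atoms of $B$. $\mathrm{CO}(X)$ is the set of clopen subsets of a space $X$. For a Boolean algebra $A$ and $a\in A$, put $s_A(a)=\{x\in \mathbf{Boole}(A,\mathbf 2)\mid x(a)=1\}$; the Stone space $\mathsf S(A)$ is $\mathbf{Boole}(A,\mathbf 2)$ with the topology having $\{s_A(a)\mid a\in A\}$ as a base. For $X\subseteq \mathbf{Boole}(A,\mathbf 2)$ put $s_A^X(a)=X\cap s_A(a)$. A Boolean z-algebra is a pair $(A,X)$, where $A$ is a Boolean algebra and $X\subseteq\mathbf{Boole}(A,\mathbf 2)$, such that for each $a\in A\setminus\{0\}$ there is $x\in X$ with $x(a)=1$. A Boolean dz-algebra is a Boolean z-algebra $(A,X)$ such that $s_A^X(A)=\mathrm{CO}(X)$, where $X$ carries the subspace topology from $\mathsf S(A)$. $\mathbf{dzBoole}$ is the category whose objects are all Boolean dz-algebras and whose morphisms $(A,X)\to(A',X')$ are all pairs $(\varphi,f)$ with $\varphi:A\to A'$ a Boolean homomorphism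 and $f:X'\to X$ a function such that $x'\circ\varphi=f(x')$ for every $x'\in X'$; composition is $(\varphi',f')\circ(\varphi,f)=(\varphi'\circ\varphi,f\circ f')$ and identities are $(id_A,id_X)$. For $B\in\mathbf{Caba}$ and $x\in\mathrm{At}(B)$ let $\check x:B\to\mathbf 2$ be given by $\check x(b)=1\Leftrightarrow x\le b$; put $\check X_B=\{\check x\mid x\in\mathrm{At}(B)\}$. A Boolean T-algebra is a pair $(B,\check X_B)$ with $B\in\mathbf{Caba}$ (such a pair is a Boolean dz-algebra). $\mathbf{TBoole}$ is the full subcategory of $\mathbf{dzBoole}$ whose objects are all Boolean T-algebras. For a Boolean homomorphism $\alpha:A\to B$ and $x\in\mathrm{At}(B)$, let $\alpha_x:A\to\mathbf 2$ be given by $\alpha_x(a)=1\Leftrightarrow x\le\alpha(a)$; put $X_\alpha=\{\alpha_x\mid x\in\mathrm{At}(B)\}$. For a Boolean algebra $A$ and $B\in\mathbf{Caba}$, a Boolean monomorphism $\alpha:A\to B$ is a Boolean z-map if every atom of $B$ is a meet of some elements of $\alpha(A)$; it is an mz-map if moreover $\mathrm{CO}(X_\alpha)=s_A^{X_\alpha}(A)$, where $X_\alpha$ is a subspace of $\mathsf S(A)$. $\mathbf{mzMaps}$ is the category whose objects are all mz-maps and whose morphisms from $\alpha:A\to B$ to $\alpha':A'\to B'$ are all pairs $(\varphi,\sigma)$ with $\varphi:A\to A'$ a Boolean homomorphism, $\sigma:B\to B'$ a complete Boolean homomorphism and $\alpha'\circ\varphi=\sigma\circ\alpha$; composition is componentwise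 and identities are $(id_A,id_B)$. A Boolean T-map is an identity map $id_B:B\to B$ with $B\in\mathbf{Caba}$ (such a map is an mz-map). $\mathbf{TMaps}$ is the full subcategory of $\mathbf{mzMaps}$ whose objects are all Boolean T-maps. Two categories are dually equivalent if there are contravariant functors between them in both directions whose two composites are naturally isomorphic to the identity functors. *)

theory Defs
  imports
    "HOL-Library.Equipollence"
    "HOL-Algebra.Complete_Lattice"
    "HOL-Analysis.Abstract_Topology"
begin

section \<open>Categories and dual equivalence\<close>

text \<open>Hom-sets are indexed by their end points and need not be disjoint.
  \<open>Comp C a b c g f\<close> is the composite \<open>g \<circ> f\<close> of \<open>f : a \<rightarrow> b\<close> and \<open>g : b \<rightarrow> c\<close>.\<close>

record ('o, 'm) category_data =
  Obj :: "'o set"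
  Hom :: "'o \<Rightarrow> 'o \<Rightarrow> 'm set"
  Id :: "'o \<Rightarrow> 'm"
  Comp :: "'o \<Rightarrow> 'o \<Rightarrow> 'o \<Rightarrow> 'm \<Rightarrow> 'm \<Rightarrow> 'm"

locale category =
  fixes C :: "('o, 'm) category_data"
  assumes Id_Hom: "a \<in> Obj C \<Longrightarrow> Id C a \<in> Hom C a a"
    and Comp_Hom:
      "\<lbrakk>a \<in> Obj C; b \<in> Obj C; c \<in> Obj C; f \<in> Hom C a b; g \<in> Hom C b c\<rbrakk>
        \<Longrightarrow> Comp C a b c g f \<in> Hom C a c"
    and Comp_Id_right:
      "\<lbrakk>a \<in> Obj C; b \<in> Obj C; f \<in> Hom C a b\<rbrakk> \<Longrightarrow> Comp C a a b f (Id C a) = f"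
    and Comp_Id_left:
      "\<lbrakk>a \<in> Obj C; b \<in> Obj C; f \<in> Hom C a b\<rbrakk> \<Longrightarrow> Comp C a b b (Id C b) f = f"
    and Comp_assoc:
      "\<lbrakk>a \<in> Obj C; b \<in> Obj C; c \<in> Obj C; d \<in> Obj C;
        f \<in> Hom C a b; g \<in> Hom C b c; h \<in> Hom C c d\<rbrakk>
        \<Longrightarrow> Comp C a b d (Comp C b c d h g) f = Comp C a c d h (Comp C a b c g f)"

definition full_subcategory :: "('o, 'm) category_data \<Rightarrow> 'o set \<Rightarrow> ('o, 'm) category_data" where
  "full_subcategory C S = C\<lparr>Obj := S\<rparr>"

definition is_iso :: "('o, 'm) category_data \<Rightarrow> 'o \<Rightarrow> 'o \<Rightarrow> 'm \<Rightarrow> bool" where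
  "is_iso C a b f \<longleftrightarrow> f \<in> Hom C a b \<and>
     (\<exists>g \<in> Hom C b a. Comp C a b a g f = Id C a \<and> Comp C b a b f g = Id C b)"

record ('o, 'm, 'p, 'n) functor_data =
  obj_map :: "'o \<Rightarrow> 'p"
  arr_map :: "'o \<Rightarrow> 'o \<Rightarrow> 'm \<Rightarrow> 'n"

locale contravariant_functor = source: category C + target: category D
  for C :: "('o, 'm) category_data" and D :: "('p, 'n) category_data" +
  fixes F :: "('o, 'm, 'p, 'n) functor_data"
  assumes obj_map_Obj: "a \<in> Obj C \<Longrightarrow> obj_map F a \<in> Obj D"
    and arr_map_Hom:
      "\<lbrakk>a \<in> Obj C; b \<in> Obj C; f \<in> Hom C a b\<rbrakk>
        \<Longrightarrow> arr_map F a b f \<in> Hom D (obj_map F b) (obj_map F a)"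
    and arr_map_Id: "a \<in> Obj C \<Longrightarrow> arr_map F a a (Id C a) = Id D (obj_map F a)"
    and arr_map_Comp:
      "\<lbrakk>a \<in> Obj C; b \<in> Obj C; c \<in> Obj C; f \<in> Hom C a b; g \<in> Hom C b c\<rbrakk>
        \<Longrightarrow> arr_map F a c (Comp C a b c g f) =
            Comp D (obj_map F c) (obj_map F b) (obj_map F a) (arr_map F a b f) (arr_map F b c g)"

definition identity_functor :: "('o, 'm, 'o, 'm) functor_data" where
  "identity_functor = \<lparr>obj_map = (\<lambda>a. a), arr_map = (\<lambda>a b f. f)\<rparr>"

text \<open>The composite \<open>G \<circ> F\<close> of two contravariant functors; \<open>F\<close> sends \<open>f : a \<rightarrow> b\<close> to an arrow
  from \<open>F b\<close> to \<open>F a\<close>, hence the order of the object arguments of \<open>arr_map G\<close>.\<close>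

definition contra_compose ::
  "('p, 'n, 'q, 'k) functor_data \<Rightarrow> ('o, 'm, 'p, 'n) functor_data \<Rightarrow> ('o, 'm, 'q, 'k) functor_data"
where
  "contra_compose G F =
     \<lparr>obj_map = (\<lambda>a. obj_map G (obj_map F a)),
      arr_map = (\<lambda>a b f. arr_map G (obj_map F b) (obj_map F a) (arr_map F a b f))\<rparr>"

definition naturally_isomorphic ::
  "('o, 'm) category_data \<Rightarrow> ('p, 'n) category_data \<Rightarrow>
   ('o, 'm, 'p, 'n) functor_data \<Rightarrow> ('o, 'm, 'p, 'n) functor_data \<Rightarrow> bool"
where
  "naturally_isomorphic C D H K \<longleftrightarrow>
     (\<exists>\<eta>. (\<forall>a \<in> Obj C. is_iso D (obj_map H a) (obj_map K a) (\<eta> a)) \<and>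
          (\<forall>a \<in> Obj C. \<forall>b \<in> Obj C. \<forall>f \<in> Hom C a b.
             Comp D (obj_map H a) (obj_map H b) (obj_map K b) (\<eta> b) (arr_map H a b f) =
             Comp D (obj_map H a) (obj_map K a) (obj_map K b) (arr_map K a b f) (\<eta> a)))"

definition dually_equivalent ::
  "('o, 'm) category_data \<Rightarrow> ('p, 'n) category_data \<Rightarrow> bool"
where
  "dually_equivalent C D \<longleftrightarrow> category C \<and> category D \<and>
     (\<exists>F G. contravariant_functor C D F \<and> contravariant_functor D C G \<and>
        naturally_isomorphic C C (contra_compose G F) identity_functor \<and>
        naturally_isomorphic D D (contra_compose F G) identity_functor)"


section \<open>Boolean algebras\<close>

text \<open>Boolean algebras are complemented distributive lattices on a carrier set;
  one-element algebras are allowed. Functions between carriers are kept extensional,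
  so that equal arrows are equal as HOL functions.\<close>

definition is_complement :: "'a gorder \<Rightarrow> 'a \<Rightarrow> 'a \<Rightarrow> bool" where
  "is_complement L x y \<longleftrightarrow> y \<in> carrier L \<and> x \<squnion>\<^bsub>L\<^esub> y = \<top>\<^bsub>L\<^esub> \<and> x \<sqinter>\<^bsub>L\<^esub> y = \<bottom>\<^bsub>L\<^esub>"

locale boolean_lattice = bounded_lattice L for L :: "'a gorder" (structure) +
  assumes meet_join_distrib:
      "\<lbrakk>x \<in> carrier L; y \<in> carrier L; z \<in> carrier L\<rbrakk>
        \<Longrightarrow> x \<sqinter> (y \<squnion> z) = (x \<sqinter> y) \<squnion> (x \<sqinter> z)"
    and complement_exists: "x \<in> carrier L \<Longrightarrow> \<exists>y. is_complement L x y"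

definition complement :: "'a gorder \<Rightarrow> 'a \<Rightarrow> 'a" where
  "complement L x = (THE y. is_complement L x y)"

definition boole_hom :: "'a gorder \<Rightarrow> 'b gorder \<Rightarrow> ('a \<Rightarrow> 'b) set" where
  "boole_hom A B = {f \<in> carrier A \<rightarrow>\<^sub>E carrier B.
     (\<forall>x \<in> carrier A. \<forall>y \<in> carrier A. f (x \<squnion>\<^bsub>A\<^esub> y) = f x \<squnion>\<^bsub>B\<^esub> f y) \<and>
     (\<forall>x \<in> carrier A. \<forall>y \<in> carrier A. f (x \<sqinter>\<^bsub>A\<^esub> y) = f x \<sqinter>\<^bsub>B\<^esub> f y) \<and>
     (\<forall>x \<in> carrier A. f (complement A x) = complement B (f x)) \<and>
     f \<bottom>\<^bsub>A\<^esub> = \<bottom>\<^bsub>B\<^esub> \<and> f \<top>\<^bsub>A\<^esub> = \<top>\<^bsub>B\<^esub>}"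

definition two :: "bool gorder" where
  "two = \<lparr>carrier = UNIV, eq = (=), le = (\<le>)\<rparr>"

definition atoms :: "'a gorder \<Rightarrow> 'a set" where
  "atoms B = {x \<in> carrier B. x \<noteq> \<bottom>\<^bsub>B\<^esub> \<and>
     (\<forall>y \<in> carrier B. y \<sqsubseteq>\<^bsub>B\<^esub> x \<longrightarrow> y = \<bottom>\<^bsub>B\<^esub> \<or> y = x)}"

definition caba :: "'a gorder \<Rightarrow> bool" where
  "caba B \<longleftrightarrow> boolean_lattice B \<and> complete_lattice B \<and>
     (\<forall>b \<in> carrier B. b \<noteq> \<bottom>\<^bsub>B\<^esub> \<longrightarrow> (\<exists>x \<in> atoms B. x \<sqsubseteq>\<^bsub>B\<^esub> b))"

definition complete_boole_hom :: "'a gorder \<Rightarrow> 'b gorder \<Rightarrow> ('a \<Rightarrow> 'b) set" where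
  "complete_boole_hom A B = {f \<in> boole_hom A B. sup_pres A B f \<and> inf_pres A B f}"


section \<open>Stone spaces, Boolean dz-algebras and T-algebras\<close>

definition stone_set :: "'a gorder \<Rightarrow> 'a \<Rightarrow> ('a \<Rightarrow> bool) set" where
  "stone_set A a = {x \<in> boole_hom A two. x a}"

definition stone_space :: "'a gorder \<Rightarrow> ('a \<Rightarrow> bool) topology" where
  "stone_space A = topology (arbitrary union_of (\<lambda>S. S \<in> stone_set A ` carrier A))"

definition clopens :: "'x topology \<Rightarrow> 'x set set" where
  "clopens T = {S. openin T S \<and> closedin T S}"

type_synonym 'a z_algebra = "'a gorder \<times> ('a \<Rightarrow> bool) set"

definition boolean_z_algebra :: "'a z_algebra \<Rightarrow> bool" where
  "boolean_z_algebra = (\<lambda>(A, X). boolean_lattice A \<and> X \<subseteq> boole_hom A two \<and>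
     (\<forall>a \<in> carrier A - {\<bottom>\<^bsub>A\<^esub>}. \<exists>x \<in> X. x a))"

definition boolean_dz_algebra :: "'a z_algebra \<Rightarrow> bool" where
  "boolean_dz_algebra = (\<lambda>(A, X). boolean_z_algebra (A, X) \<and>
     (\<lambda>a. X \<inter> stone_set A a) ` carrier A = clopens (subtopology (stone_space A) X))"

text \<open>For a Boolean homomorphism \<open>\<alpha> : A \<rightarrow> B\<close> and \<open>x\<close> in \<open>B\<close> this is \<open>\<alpha>\<^sub>x\<close>;
  for the identity of \<open>B\<close> it is the characteristic function of the principal filter of \<open>x\<close>.\<close>

definition point_of :: "'a gorder \<Rightarrow> ('a \<Rightarrow> 'b) \<Rightarrow> 'b gorder \<Rightarrow> 'b \<Rightarrow> ('a \<Rightarrow> bool)" where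
  "point_of A \<alpha> B x = (\<lambda>a \<in> carrier A. x \<sqsubseteq>\<^bsub>B\<^esub> \<alpha> a)"

definition points_of :: "'a gorder \<Rightarrow> ('a \<Rightarrow> 'b) \<Rightarrow> 'b gorder \<Rightarrow> ('a \<Rightarrow> bool) set" where
  "points_of A \<alpha> B = point_of A \<alpha> B ` atoms B"

definition atom_points :: "'a gorder \<Rightarrow> ('a \<Rightarrow> bool) set" where
  "atom_points B = (\<lambda>x. \<lambda>b \<in> carrier B. x \<sqsubseteq>\<^bsub>B\<^esub> b) ` atoms B"

definition boolean_T_algebra :: "'a z_algebra \<Rightarrow> bool" where
  "boolean_T_algebra = (\<lambda>(B, X). caba B \<and> X = atom_points B)"

text \<open>In the categories below, \<open>U\<close> is the collection of sets allowed as carriers.\<close>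

definition dzBoole ::
  "'a set set \<Rightarrow> ('a z_algebra, ('a \<Rightarrow> 'a) \<times> (('a \<Rightarrow> bool) \<Rightarrow> ('a \<Rightarrow> bool))) category_data"
where
  "dzBoole U =
     \<lparr>Obj = {(A, X). carrier A \<in> U \<and> boolean_dz_algebra (A, X)},
      Hom = (\<lambda>(A, X) (A', X'). {(\<phi>, f). \<phi> \<in> boole_hom A A' \<and> f \<in> X' \<rightarrow>\<^sub>E X \<and>
               (\<forall>x' \<in> X'. compose (carrier A) x' \<phi> = f x')}),
      Id = (\<lambda>(A, X). (\<lambda>a \<in> carrier A. a, \<lambda>x \<in> X. x)),
      Comp = (\<lambda>(A, X) (A', X') (A'', X'') (\<phi>', f') (\<phi>, f).
               (compose (carrier A) \<phi>' \<phi>, compose X'' f f'))\<rparr>"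

definition TBoole ::
  "'a set set \<Rightarrow> ('a z_algebra, ('a \<Rightarrow> 'a) \<times> (('a \<Rightarrow> bool) \<Rightarrow> ('a \<Rightarrow> bool))) category_data"
where
  "TBoole U = full_subcategory (dzBoole U) {(B, X). carrier B \<in> U \<and> boolean_T_algebra (B, X)}"


section \<open>Boolean mz-maps and T-maps\<close>

text \<open>A map \<open>\<alpha> : A \<rightarrow> B\<close> is represented by the triple \<open>(A, \<alpha>, B)\<close>.\<close>

type_synonym 'a z_map = "'a gorder \<times> ('a \<Rightarrow> 'a) \<times> 'a gorder"

definition boolean_z_map :: "'a z_map \<Rightarrow> bool" where
  "boolean_z_map = (\<lambda>(A, \<alpha>, B). boolean_lattice A \<and> caba B \<and>
     \<alpha> \<in> boole_hom A B \<and> inj_on \<alpha> (carrier A) \<and>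
     (\<forall>x \<in> atoms B. \<exists>S \<subseteq> \<alpha> ` carrier A. x = \<Sqinter>\<^bsub>B\<^esub> S))"

definition boolean_mz_map :: "'a z_map \<Rightarrow> bool" where
  "boolean_mz_map = (\<lambda>(A, \<alpha>, B). boolean_z_map (A, \<alpha>, B) \<and>
     clopens (subtopology (stone_space A) (points_of A \<alpha> B)) =
       (\<lambda>a. points_of A \<alpha> B \<inter> stone_set A a) ` carrier A)"

definition boolean_T_map :: "'a z_map \<Rightarrow> bool" where
  "boolean_T_map = (\<lambda>(A, \<alpha>, B). caba B \<and> A = B \<and> \<alpha> = (\<lambda>b \<in> carrier B. b))"

definition mzMaps :: "'a set set \<Rightarrow> ('a z_map, ('a \<Rightarrow> 'a) \<times> ('a \<Rightarrow> 'a)) category_data" where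
  "mzMaps U =
     \<lparr>Obj = {(A, \<alpha>, B). carrier A \<in> U \<and> carrier B \<in> U \<and> boolean_mz_map (A, \<alpha>, B)},
      Hom = (\<lambda>(A, \<alpha>, B) (A', \<alpha>', B'). {(\<phi>, \<sigma>). \<phi> \<in> boole_hom A A' \<and>
               \<sigma> \<in> complete_boole_hom B B' \<and>
               compose (carrier A) \<alpha>' \<phi> = compose (carrier A) \<sigma> \<alpha>}),
      Id = (\<lambda>(A, \<alpha>, B). (\<lambda>a \<in> carrier A. a, \<lambda>b \<in> carrier B. b)),
      Comp = (\<lambda>(A, \<alpha>, B) (A', \<alpha>', B') (A'', \<alpha>'', B'') (\<phi>', \<sigma>') (\<phi>, \<sigma>).
               (compose (carrier A) \<phi>' \<phi>, compose (carrier B) \<sigma>' \<sigma>))\<rparr>"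

definition TMaps :: "'a set set \<Rightarrow> ('a z_map, ('a \<Rightarrow> 'a) \<times> ('a \<Rightarrow> 'a)) category_data" where
  "TMaps U = full_subcategory (mzMaps U)
     {(A, \<alpha>, B). carrier A \<in> U \<and> carrier B \<in> U \<and> boolean_T_map (A, \<alpha>, B)}"


section \<open>Discrete spaces and sets\<close>

definition discrete_spaces :: "'x set set \<Rightarrow> ('x topology, 'x \<Rightarrow> 'x) category_data" where
  "discrete_spaces V =
     \<lparr>Obj = {T. topspace T \<in> V \<and> T = discrete_topology (topspace T)},
      Hom = (\<lambda>T T'. {f \<in> extensional (topspace T). continuous_map T T' f}),
      Id = (\<lambda>T. \<lambda>x \<in> topspace T. x),
      Comp = (\<lambda>T T' T'' g f. compose (topspace T) g f)\<rparr>"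

definition sets_category :: "'x set set \<Rightarrow> ('x set, 'x \<Rightarrow> 'x) category_data" where
  "sets_category V =
     \<lparr>Obj = V,
      Hom = (\<lambda>X Y. X \<rightarrow>\<^sub>E Y),
      Id = (\<lambda>X. \<lambda>x \<in> X. x),
      Comp = (\<lambda>X Y Z g f. compose X g f)\<rparr>"


section \<open>Size\<close>

text \<open>HOL has no type of all sets, so ``all algebras'' means all algebras with carrier in a
  collection \<open>U\<close>, and ``all sets'' (and spaces) means all those in a collection \<open>V\<close>.
  The duality exchanges \<open>X\<close> with an algebra of the size of the power set of \<open>X\<close>, so \<open>U\<close> and \<open>V\<close>
  must correspond under power sets. A universe \<open>U = V\<close> closed under
  subsets and power sets is the usual instance; the lemmas below also give, for an arbitrary
  \<open>U\<close> over an arbitrary type, a matching \<open>V\<close>.\<close>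

definition power_matched :: "'a set set \<Rightarrow> 'x set set \<Rightarrow> bool" where
  "power_matched U V \<longleftrightarrow>
     (\<forall>X \<in> V. \<exists>A \<in> U. A \<approx> Pow X) \<and>
     (\<forall>A \<in> U. \<forall>Y \<subseteq> A. A \<approx> Pow Y \<longrightarrow> (\<exists>X \<in> V. X \<approx> Y))"

lemma power_matched_universe:
  assumes "\<And>X Y. \<lbrakk>X \<in> U; Y \<subseteq> X\<rbrakk> \<Longrightarrow> Y \<in> U"
    and "\<And>X. X \<in> U \<Longrightarrow> \<exists>A \<in> U. A \<approx> Pow X"
  shows "power_matched U U"
  unfolding power_matched_def using assms by (meson eqpoll_refl)

lemma power_matched_any:
  fixes U :: "'a set set"
  shows "power_matched U {X :: 'a set. \<exists>A \<in> U. A \<approx> Pow X}"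
  unfolding power_matched_def using eqpoll_refl by blast


section \<open>T-algebras are dz-algebras and T-maps are mz-maps\<close>

context boolean_lattice
begin

lemma complement_le:
  assumes "is_complement L x y" "x \<in> carrier L" "z \<in> carrier L" "z \<sqinter> x = \<bottom>"
  shows "z \<sqsubseteq> y"
proof -
  have y: "y \<in> carrier L" "x \<squnion> y = \<top>" using assms by (auto simp: is_complement_def)
  have "z = z \<sqinter> \<top>"
    using assms(3) le_iff_join top_closed top_higher by blast
  also have "\<dots> = (z \<sqinter> x) \<squnion> (z \<sqinter> y)" using y assms meet_join_distrib by metis
  also have "\<dots> = z \<sqinter> y"
    using assms y le_iff_meet[of \<bottom> "z \<sqinter> y"] by simp
  finally show ?thesis using assms y meet_right[of z y] by simp
qed

lemma complement_unique:
  assumes "is_complement L x y" "is_complement L x z" "x \<in> carrier L"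
  shows "y = z"
proof -
  have "y \<in> carrier L" "z \<in> carrier L" "y \<sqinter> x = \<bottom>" "z \<sqinter> x = \<bottom>"
    using assms by (auto simp: is_complement_def meet_comm)
  then show ?thesis using assms complement_le le_antisym by blast
qed

lemma complement_is_complement: "x \<in> carrier L \<Longrightarrow> is_complement L x (complement L x)"
  unfolding complement_def using complement_exists complement_unique by (metis theI)

lemma atom_meet:
  assumes "x \<in> atoms L" "a \<in> carrier L" "\<not> x \<sqsubseteq> a"
  shows "x \<sqinter> a = \<bottom>"
  using assms unfolding atoms_def
  by (metis (mono_tags, lifting) meet_closed meet_left meet_right mem_Collect_eq)

lemma atom_le_join:
  assumes "x \<in> atoms L" "a \<in> carrier L" "b \<in> carrier L"
  shows "x \<sqsubseteq> a \<squnion> b \<longleftrightarrow> x \<sqsubseteq> a \<or> x \<sqsubseteq> b"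
proof
  have x: "x \<in> carrier L" "x \<noteq> \<bottom>" using assms by (auto simp: atoms_def)
  assume le: "x \<sqsubseteq> a \<squnion> b"
  show "x \<sqsubseteq> a \<or> x \<sqsubseteq> b"
  proof (rule ccontr)
    assume "\<not> ?thesis"
    then have "x \<sqinter> a = \<bottom>" "x \<sqinter> b = \<bottom>" using atom_meet assms by auto
    then have "x \<sqinter> (a \<squnion> b) = \<bottom>"
      using x assms le_iff_meet[of \<bottom> \<bottom>] by (simp add: meet_join_distrib)
    then show False using x le assms le_iff_join[of x "a \<squnion> b"] by simp
  qed
next
  have x: "x \<in> carrier L" using assms by (auto simp: atoms_def)
  assume "x \<sqsubseteq> a \<or> x \<sqsubseteq> b"
  then show "x \<sqsubseteq> a \<squnion> b"
    using x assms by (meson join_closed join_left join_right le_trans)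
qed

lemma atom_le_meet:
  assumes "x \<in> atoms L" "a \<in> carrier L" "b \<in> carrier L"
  shows "x \<sqsubseteq> a \<sqinter> b \<longleftrightarrow> x \<sqsubseteq> a \<and> x \<sqsubseteq> b"
proof -
  have x: "x \<in> carrier L" using assms by (auto simp: atoms_def)
  show ?thesis using x assms
    by (meson le_trans meet_closed meet_le meet_left meet_right)
qed

lemma atom_not_le_bottom: "x \<in> atoms L \<Longrightarrow> \<not> x \<sqsubseteq> \<bottom>"
  unfolding atoms_def by (metis (mono_tags, lifting) bottom_closed bottom_lower le_antisym mem_Collect_eq)

lemma atom_le_top: "x \<in> atoms L \<Longrightarrow> x \<sqsubseteq> \<top>"
  unfolding atoms_def by simp

lemma atom_le_complement:
  assumes "x \<in> atoms L" "a \<in> carrier L"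
  shows "x \<sqsubseteq> complement L a \<longleftrightarrow> \<not> x \<sqsubseteq> a"
proof -
  have c: "complement L a \<in> carrier L" "a \<squnion> complement L a = \<top>" "a \<sqinter> complement L a = \<bottom>"
    using complement_is_complement[OF assms(2)] by (auto simp: is_complement_def)
  show ?thesis
    using atom_le_join[OF assms c(1)] atom_le_meet[OF assms c(1)] c
      atom_le_top[OF assms(1)] atom_not_le_bottom[OF assms(1)] by auto
qed

end

lemma boolean_lattice_two: "boolean_lattice two"
  and two_simps [simp]: "carrier two = UNIV" "\<bottom>\<^bsub>two\<^esub> = False" "\<top>\<^bsub>two\<^esub> = True"
    "x \<squnion>\<^bsub>two\<^esub> y = (x \<or> y)" "x \<sqinter>\<^bsub>two\<^esub> y = (x \<and> y)" "complement two x = (\<not> x)"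
proof -
  have po: "partial_order two"
    by unfold_locales (auto simp: two_def)
  interpret partial_order two by (rule po)
  have lub: "least two (x \<or> y) (Upper two {x, y})" for x y
    by (auto simp: least_def Upper_def two_def)
  have glb: "greatest two (x \<and> y) (Lower two {x, y})" for x y
    by (auto simp: greatest_def Lower_def two_def)
  have bot: "least two False (carrier two)" and top: "greatest two True (carrier two)"
    by (auto simp: least_def greatest_def two_def)
  have bl: "bounded_lattice two"
    by unfold_locales (use lub glb bot top in blast)+
  interpret bounded_lattice two by (rule bl)
  show carrier_two: "carrier two = UNIV" by (simp add: two_def)
  show b: "\<bottom>\<^bsub>two\<^esub> = False" using bot by (metis bottom_least least_unique)
  show t: "\<top>\<^bsub>two\<^esub> = True" using top by (metis top_greatest greatest_unique)
  show j: "x \<squnion>\<^bsub>two\<^esub> y = (x \<or> y)" for x y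
    unfolding join_def Lattice.sup_def by (rule some_equality) (use lub least_unique in blast)+
  show m: "x \<sqinter>\<^bsub>two\<^esub> y = (x \<and> y)" for x y
    unfolding meet_def Lattice.inf_def by (rule some_equality) (use glb greatest_unique in blast)+
  have c: "is_complement two x y \<longleftrightarrow> y = (\<not> x)" for x y
    unfolding is_complement_def carrier_two b t j m by auto
  then show "complement two x = (\<not> x)" by (simp add: complement_def)
  show "boolean_lattice two"
    by unfold_locales (auto simp: c m j)
qed

lemma atom_points_subset:
  assumes "caba B" shows "atom_points B \<subseteq> boole_hom B two"
proof -
  interpret boolean_lattice B using assms by (simp add: caba_def)
  have "complement B a \<in> carrier B" if "a \<in> carrier B" for a
    using complement_is_complement[OF that] by (simp add: is_complement_def)
  then show ?thesis
    by (auto simp: atom_points_def boole_hom_def atom_le_join atom_le_meet atom_le_complement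
        atom_not_le_bottom atom_le_top)
qed

lemma openin_stone_space:
  assumes "boolean_lattice A"
  shows "openin (stone_space A) = arbitrary union_of (\<lambda>S. S \<in> stone_set A ` carrier A)"
proof -
  interpret boolean_lattice A by fact
  have "stone_set A a \<inter> stone_set A b = stone_set A (a \<sqinter>\<^bsub>A\<^esub> b)"
    if "a \<in> carrier A" "b \<in> carrier A" for a b
    using that by (auto simp: stone_set_def boole_hom_def)
  then have "istopology (arbitrary union_of (\<lambda>S. S \<in> stone_set A ` carrier A))"
    by (intro istopology_base) auto
  then show ?thesis by (simp add: stone_space_def topology_inverse')
qed

lemma clopens_stone_set:
  assumes "boolean_lattice A" "X \<subseteq> boole_hom A two" "a \<in> carrier A"
  shows "X \<inter> stone_set A a \<in> clopens (subtopology (stone_space A) X)"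
proof -
  interpret boolean_lattice A by fact
  have op: "openin (stone_space A) (stone_set A b)" if "b \<in> carrier A" for b
    using that assms(1) by (auto simp: openin_stone_space arbitrary_def intro!: union_of_inc)
  have c: "complement A a \<in> carrier A"
    using complement_is_complement[OF assms(3)] by (simp add: is_complement_def)
  have "stone_set A \<top>\<^bsub>A\<^esub> = boole_hom A two" by (auto simp: stone_set_def boole_hom_def)
  then have sub: "topspace (subtopology (stone_space A) X) = X"
    using op[of "\<top>\<^bsub>A\<^esub>"] assms(2) openin_subset by (fastforce simp: topspace_subtopology)
  have "X - X \<inter> stone_set A a = X \<inter> stone_set A (complement A a)"
    using assms(2,3) by (auto simp: stone_set_def boole_hom_def)
  then show ?thesis
    unfolding clopens_def closedin_def sub
    using op[OF c] op[OF assms(3)] by (auto simp: openin_subtopology_Int2 sub)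
qed

lemma atom_points_separate:
  assumes B: "caba B" and T: "T \<subseteq> atom_points B"
  shows "\<exists>a \<in> carrier B. T = atom_points B \<inter> stone_set B a"
proof -
  interpret boolean_lattice B using B by (simp add: caba_def)
  interpret cl: complete_lattice B using B by (simp add: caba_def)
  define pt where "pt = (\<lambda>x. \<lambda>b \<in> carrier B. x \<sqsubseteq>\<^bsub>B\<^esub> b)"
  define S where "S = {x \<in> atoms B. pt x \<in> T}"
  have S: "S \<subseteq> carrier B" by (auto simp: S_def atoms_def)
  define s where "s = \<Squnion>\<^bsub>B\<^esub>S"
  have s: "s \<in> carrier B" using S by (simp add: s_def)
  have le: "x \<sqsubseteq>\<^bsub>B\<^esub> s \<longleftrightarrow> x \<in> S" if x: "x \<in> atoms B" for x
  proof
    have xc: "x \<in> carrier B" using x by (simp add: atoms_def)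
    show "x \<in> S \<Longrightarrow> x \<sqsubseteq>\<^bsub>B\<^esub> s" unfolding s_def using S cl.sup_upper by blast
    assume xs: "x \<sqsubseteq>\<^bsub>B\<^esub> s"
    show "x \<in> S"
    proof (rule ccontr)
      assume "x \<notin> S"
      have c: "complement B x \<in> carrier B"
        using complement_is_complement[OF xc] by (simp add: is_complement_def)
      have "y \<sqsubseteq>\<^bsub>B\<^esub> complement B x" if "y \<in> S" for y
      proof -
        have y: "y \<in> atoms B" "y \<noteq> x" using that \<open>x \<notin> S\<close> by (auto simp: S_def)
        have "\<not> y \<sqsubseteq>\<^bsub>B\<^esub> x" using x y by (auto simp: atoms_def)
        then show ?thesis using y xc by (simp add: atom_le_complement)
      qed
      then have "s \<sqsubseteq>\<^bsub>B\<^esub> complement B x"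
        unfolding s_def using S c by (intro cl.sup_least) auto
      then have "x \<sqsubseteq>\<^bsub>B\<^esub> complement B x" using xs xc s c le_trans by blast
      then show False using x xc by (simp add: atom_le_complement)
    qed
  qed
  have "T = atom_points B \<inter> stone_set B s"
  proof (intro equalityI subsetI IntI)
    fix t assume t: "t \<in> T"
    then obtain x where x: "x \<in> atoms B" "t = pt x"
      using T by (auto simp: atom_points_def pt_def)
    then have "x \<in> S" using t by (simp add: S_def)
    moreover show "t \<in> atom_points B" using t T by auto
    ultimately show "t \<in> stone_set B s"
      using x s le atom_points_subset[OF B] by (auto simp: stone_set_def pt_def)
  next
    fix t assume "t \<in> atom_points B \<inter> stone_set B s"
    then obtain x where x: "x \<in> atoms B" "t = pt x" "t s"
      by (auto simp: atom_points_def pt_def stone_set_def)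
    then have "x \<in> S" using s le by (auto simp: pt_def)
    then show "t \<in> T" using x by (simp add: S_def)
  qed
  then show ?thesis using s by blast
qed

lemma atom_points_clopens:
  assumes "caba B"
  shows "(\<lambda>a. atom_points B \<inter> stone_set B a) ` carrier B =
    clopens (subtopology (stone_space B) (atom_points B))"
proof
  have "boolean_lattice B" using assms by (simp add: caba_def)
  then show "(\<lambda>a. atom_points B \<inter> stone_set B a) ` carrier B
      \<subseteq> clopens (subtopology (stone_space B) (atom_points B))"
    by (intro image_subsetI clopens_stone_set atom_points_subset[OF assms])
  show "clopens (subtopology (stone_space B) (atom_points B))
      \<subseteq> (\<lambda>a. atom_points B \<inter> stone_set B a) ` carrier B"
  proof
    fix T assume "T \<in> clopens (subtopology (stone_space B) (atom_points B))"
    then have "T \<subseteq> atom_points B"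
      by (auto simp: clopens_def dest: openin_imp_subset)
    then show "T \<in> (\<lambda>a. atom_points B \<inter> stone_set B a) ` carrier B"
      using atom_points_separate[OF assms] by (simp add: image_iff)
  qed
qed

lemma boolean_T_algebra_dz:
  assumes "boolean_T_algebra (B, X)" shows "boolean_dz_algebra (B, X)"
proof -
  have B: "caba B" and X: "X = atom_points B" using assms by (auto simp: boolean_T_algebra_def)
  have "\<exists>x \<in> atom_points B. x a" if "a \<in> carrier B" "a \<noteq> \<bottom>\<^bsub>B\<^esub>" for a
    using B that by (auto simp: caba_def atom_points_def)
  then show ?thesis
    using B atom_points_subset[OF B] atom_points_clopens[OF B]
    by (auto simp: boolean_dz_algebra_def boolean_z_algebra_def X caba_def)
qed

lemma boolean_T_map_mz:
  assumes "boolean_T_map (A, \<alpha>, B)" shows "boolean_mz_map (A, \<alpha>, B)"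
proof -
  have B: "caba B" and [simp]: "A = B" and \<alpha>: "\<alpha> = (\<lambda>b \<in> carrier B. b)"
    using assms by (auto simp: boolean_T_map_def)
  interpret boolean_lattice B using B by (simp add: caba_def)
  have c: "complement B a \<in> carrier B" if "a \<in> carrier B" for a
    using complement_is_complement[OF that] by (simp add: is_complement_def)
  have hom: "\<alpha> \<in> boole_hom B B" using c by (auto simp: \<alpha> boole_hom_def)
  have "points_of B \<alpha> B = atom_points B"
    unfolding points_of_def point_of_def atom_points_def \<alpha>
    by (intro image_cong refl) (auto simp: restrict_def)
  moreover have "\<exists>S \<subseteq> \<alpha> ` carrier B. x = \<Sqinter>\<^bsub>B\<^esub> S" if "x \<in> atoms B" for x
  proof -
    have x: "x \<in> carrier B" using that by (simp add: atoms_def)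
    then have "x = \<Sqinter>\<^bsub>B\<^esub> {x}" by (simp add: inf_of_singleton)
    then show ?thesis using x by (intro exI[of _ "{x}"]) (auto simp: \<alpha>)
  qed
  ultimately show ?thesis
    using B hom atom_points_clopens[OF B]
    by (auto simp: boolean_mz_map_def boolean_z_map_def \<alpha> caba_def inj_on_def)
qed

end

(*
A complete atomic Boolean algebra B is recovered from its set of atom points: the elements of B
are separated by these points, and every set of points is the set of points of an element. Hence
any function f from the points of B' to the points of B is induced by exactly one Boolean
homomorphism B -> B', and a Boolean homomorphism is complete iff composition with it carries
points of B' to points of B. So TBoole and TMaps are both anti-isomorphic on hom-sets to sets of
functions between points, and a power set algebra on a prescribed carrier of the right size gives
essential surjectivity.
*)

theory Submission
  imports Defs
begin

section \<open>Categories represented by sets of points\<close>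

text \<open>The obstacle is size and type. Points of an algebra have type
  \<open>'a \<Rightarrow> bool\<close>, the spaces live over \<open>'x\<close>, and neither the set
  of points of an algebra nor the power set of a space need be a member of \<open>V\<close> or
  \<open>U\<close>. So no canonical functor is available: each object gets a chosen partner together
  with a bijection, and arrows are conjugated by these bijections. Only full faithfulness on points
  and these matchings are used, so one abstract theorem yields all four equivalences. The two
  categories of algebras reach the same maps of points differently. In \<open>TBoole\<close> the
  algebra part of an arrow is merely a Boolean homomorphism, but its point part must land among atom
  points, which forces completeness. In \<open>TMaps\<close> completeness is demanded of \<sigma>,
  and the commuting square identifies \<phi> with it.\<close>

text \<open>Here \<open>P\<close> and \<open>act\<close> are a fully faithful contravariant functor to sets. The unit and
  associativity laws of \<open>C\<close> are not assumed: they are reflected by faithfulness.\<close>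

locale dually_represented =
  fixes C :: "('o, 'm) category_data" and P :: "'o \<Rightarrow> 'p set"
    and act :: "'o \<Rightarrow> 'o \<Rightarrow> 'm \<Rightarrow> 'p \<Rightarrow> 'p"
  assumes Id_Hom: "a \<in> Obj C \<Longrightarrow> Id C a \<in> Hom C a a"
    and Comp_Hom:
      "\<lbrakk>a \<in> Obj C; b \<in> Obj C; c \<in> Obj C; f \<in> Hom C a b; g \<in> Hom C b c\<rbrakk>
        \<Longrightarrow> Comp C a b c g f \<in> Hom C a c"
    and act_Id: "a \<in> Obj C \<Longrightarrow> act a a (Id C a) = (\<lambda>p \<in> P a. p)"
    and act_Comp:
      "\<lbrakk>a \<in> Obj C; b \<in> Obj C; c \<in> Obj C; f \<in> Hom C a b; g \<in> Hom C b c\<rbrakk>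
        \<Longrightarrow> act a c (Comp C a b c g f) = compose (P c) (act a b f) (act b c g)"
    and act_bij: "\<lbrakk>a \<in> Obj C; b \<in> Obj C\<rbrakk> \<Longrightarrow> bij_betw (act a b) (Hom C a b) (P b \<rightarrow>\<^sub>E P a)"
begin

lemma act_PiE: "\<lbrakk>a \<in> Obj C; b \<in> Obj C; f \<in> Hom C a b\<rbrakk> \<Longrightarrow> act a b f \<in> P b \<rightarrow>\<^sub>E P a"
  using act_bij bij_betwE by blast

lemma act_mem: "\<lbrakk>a \<in> Obj C; b \<in> Obj C; f \<in> Hom C a b; p \<in> P b\<rbrakk> \<Longrightarrow> act a b f p \<in> P a"
  using act_PiE by blast

text \<open>Faithfulness in pointwise form. Every equation between arrows of \<open>C\<close> below
  is reduced by it to an equation between functions on points.\<close>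

lemma act_eqI:
  "\<lbrakk>a \<in> Obj C; b \<in> Obj C; f \<in> Hom C a b; g \<in> Hom C a b;
    \<And>p. p \<in> P b \<Longrightarrow> act a b f p = act a b g p\<rbrakk> \<Longrightarrow> f = g"
  using act_bij act_PiE by (meson PiE_ext bij_betw_imp_inj_on inj_onD)

text \<open>The inverse of \<open>act a b\<close>. Restricting \<open>h\<close> to
  \<open>P b\<close> first allows any function that maps \<open>P b\<close> into \<open>P a\<close>,
  extensional or not.\<close>

definition lift :: "'o \<Rightarrow> 'o \<Rightarrow> ('p \<Rightarrow> 'p) \<Rightarrow> 'm" where
  "lift a b h = inv_into (Hom C a b) (act a b) (restrict h (P b))"

lemma
  assumes "a \<in> Obj C" "b \<in> Obj C" "\<And>p. p \<in> P b \<Longrightarrow> h p \<in> P a"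
  shows lift_Hom: "lift a b h \<in> Hom C a b"
    and act_lift: "act a b (lift a b h) = restrict h (P b)"
proof -
  have "restrict h (P b) \<in> act a b ` Hom C a b"
    using act_bij[OF assms(1,2)] assms(3) by (simp add: bij_betw_def)
  then show "lift a b h \<in> Hom C a b" "act a b (lift a b h) = restrict h (P b)"
    unfolding lift_def by (rule inv_into_into, rule f_inv_into_f)
qed

lemma category: "category C"
proof
  fix a b c d f g h
  assume a: "a \<in> Obj C" and b: "b \<in> Obj C" and f: "f \<in> Hom C a b"
  show "Comp C a a b f (Id C a) = f"
    using a b f by (intro act_eqI[of a b])
      (simp_all add: Id_Hom Comp_Hom act_Comp act_Id compose_def act_mem)
  show "Comp C a b b (Id C b) f = f"
    using a b f by (intro act_eqI[of a b])
      (simp_all add: Id_Hom Comp_Hom act_Comp act_Id compose_def act_mem)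
  assume "c \<in> Obj C" "d \<in> Obj C" "g \<in> Hom C b c" "h \<in> Hom C c d"
  then show "Comp C a b d (Comp C b c d h g) f = Comp C a c d h (Comp C a b c g f)"
    using a b f by (intro act_eqI[of a d])
      (simp_all add: Comp_Hom act_Comp compose_def act_mem)
qed (fact Id_Hom Comp_Hom)+

end

text \<open>Stronger than the usual notion of concreteness: all functions between underlying sets
  are arrows. Both discrete spaces and plain sets fit, so they can be treated together.\<close>

locale concrete_category =
  fixes D :: "('o, 'x \<Rightarrow> 'x) category_data" and u :: "'o \<Rightarrow> 'x set"
  assumes Hom_eq: "\<lbrakk>x \<in> Obj D; y \<in> Obj D\<rbrakk> \<Longrightarrow> Hom D x y = u x \<rightarrow>\<^sub>E u y"
    and Id_eq: "x \<in> Obj D \<Longrightarrow> Id D x = (\<lambda>t \<in> u x. t)"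
    and Comp_eq: "\<lbrakk>x \<in> Obj D; y \<in> Obj D; z \<in> Obj D\<rbrakk> \<Longrightarrow> Comp D x y z g f = compose (u x) g f"
begin

lemma category: "category D"
proof
  fix x y z w f g h
  assume x: "x \<in> Obj D" and y: "y \<in> Obj D" and f: "f \<in> Hom D x y"
  show "Comp D x x y f (Id D x) = f" "Comp D x y y (Id D y) f = f"
    using x y f by (auto simp: Hom_eq Id_eq Comp_eq compose_def fun_eq_iff PiE_def extensional_def)
  assume z: "z \<in> Obj D" and g: "g \<in> Hom D y z"
  show "Comp D x y z g f \<in> Hom D x z"
    using x y z f g by (auto simp: Hom_eq Comp_eq compose_def)
  assume "w \<in> Obj D" "h \<in> Hom D z w"
  then show "Comp D x y w (Comp D y z w h g) f = Comp D x z w h (Comp D x y z g f)"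
    using x y z f g by (auto simp: Hom_eq Comp_eq compose_def fun_eq_iff)
qed (auto simp: Hom_eq Id_eq)

end

text \<open>Hom-sets already correspond, so objects only need partners up to bijection:
  \<open>e a\<close> from \<open>u (X a)\<close> onto \<open>P a\<close>, and \<open>d x\<close>
  from \<open>u x\<close> onto \<open>P (A x)\<close>. Both functors conjugate by these, and
  functoriality is the cancellation of a bijection against its inverse. The choices \<open>X\<close>
  and \<open>A\<close> are unrelated; composing \<open>d\<close> with \<open>e\<close> produces the
  natural isomorphisms.\<close>

theorem dually_equivalent_points:
  assumes C: "dually_represented C P act" and D: "concrete_category D u"
    and CD: "\<And>a. a \<in> Obj C \<Longrightarrow> \<exists>x \<in> Obj D. u x \<approx> P a"
    and DC: "\<And>x. x \<in> Obj D \<Longrightarrow> \<exists>a \<in> Obj C. u x \<approx> P a"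
  shows "dually_equivalent C D"
proof -
  interpret C: dually_represented C P act by fact
  interpret D: concrete_category D u by fact
  obtain X e where X: "X a \<in> Obj D" and e_bij: "bij_betw (e a) (u (X a)) (P a)"
    if "a \<in> Obj C" for a
    using CD unfolding eqpoll_def by metis
  obtain A d where A: "A x \<in> Obj C" and d_bij: "bij_betw (d x) (u x) (P (A x))"
    if "x \<in> Obj D" for x
    using DC unfolding eqpoll_def by metis
  define e' where "e' a = inv_into (u (X a)) (e a)" for a
  define d' where "d' x = inv_into (u x) (d x)" for x
  have e: "e a t \<in> P a" "e' a (e a t) = t" if "a \<in> Obj C" "t \<in> u (X a)" for a t
    using e_bij[OF that(1)] that(2) by (auto simp: e'_def bij_betw_inv_into_left dest: bij_betwE)
  have e': "e' a p \<in> u (X a)" "e a (e' a p) = p" if "a \<in> Obj C" "p \<in> P a" for a p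
    using e_bij[OF that(1)] that(2)
    by (auto simp: e'_def bij_betw_inv_into_right dest: bij_betw_inv_into bij_betwE)
  have d: "d x t \<in> P (A x)" "d' x (d x t) = t" if "x \<in> Obj D" "t \<in> u x" for x t
    using d_bij[OF that(1)] that(2) by (auto simp: d'_def bij_betw_inv_into_left dest: bij_betwE)
  have d': "d' x p \<in> u x" "d x (d' x p) = p" if "x \<in> Obj D" "p \<in> P (A x)" for x p
    using d_bij[OF that(1)] that(2)
    by (auto simp: d'_def bij_betw_inv_into_right dest: bij_betw_inv_into bij_betwE)
  note mem = X A e e' d d' C.act_mem
  define F where "F = \<lparr>obj_map = X, arr_map = \<lambda>a b f. \<lambda>t \<in> u (X b). e' a (act a b f (e b t))\<rparr>"
  \<comment> \<open>For \<open>g\<close> from \<open>x\<close> to \<open>y\<close> the result must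
    be an arrow from \<open>A y\<close> to \<open>A x\<close>, which acts from
    \<open>P (A x)\<close> to \<open>P (A y)\<close>, the direction of \<open>g\<close>. Being an
    arrow of \<open>C\<close> and not a function, it has to be lifted; \<open>G_arr\<close> then
    describes it by its action.\<close>
  define G where "G = \<lparr>obj_map = A, arr_map = \<lambda>x y g. C.lift (A y) (A x) (\<lambda>p. d y (g (d' x p)))\<rparr>"
  have F: "contravariant_functor C D F"
  proof (intro contravariant_functor.intro C.category D.category contravariant_functor_axioms.intro)
    fix a b c f g
    assume a: "a \<in> Obj C"
    then show "obj_map F a \<in> Obj D" by (simp add: F_def X)
    show "arr_map F a a (Id C a) = Id D (obj_map F a)"
      using a by (auto simp: F_def C.act_Id D.Id_eq mem)
    assume b: "b \<in> Obj C" and f: "f \<in> Hom C a b"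
    show "arr_map F a b f \<in> Hom D (obj_map F b) (obj_map F a)"
      using a b f by (auto simp: F_def D.Hom_eq mem)
    assume "c \<in> Obj C" "g \<in> Hom C b c"
    then show "arr_map F a c (Comp C a b c g f) =
        Comp D (obj_map F c) (obj_map F b) (obj_map F a) (arr_map F a b f) (arr_map F b c g)"
      using a b f by (auto simp: F_def D.Comp_eq C.act_Comp compose_def mem)
  qed
  have G_arr: "arr_map G x y g \<in> Hom C (A y) (A x)"
      "act (A y) (A x) (arr_map G x y g) = (\<lambda>p \<in> P (A x). d y (g (d' x p)))"
    if "x \<in> Obj D" "y \<in> Obj D" "g \<in> u x \<rightarrow>\<^sub>E u y" for x y g
  proof -
    have "d y (g (d' x p)) \<in> P (A y)" if "p \<in> P (A x)" for p
      using \<open>x \<in> Obj D\<close> \<open>y \<in> Obj D\<close> that PiE_mem[OF \<open>g \<in> u x \<rightarrow>\<^sub>E u y\<close>] by (simp add: mem)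
    then show "arr_map G x y g \<in> Hom C (A y) (A x)"
        "act (A y) (A x) (arr_map G x y g) = (\<lambda>p \<in> P (A x). d y (g (d' x p)))"
      using that by (simp_all add: G_def A C.lift_Hom C.act_lift)
  qed
  have G: "contravariant_functor D C G"
  proof (intro contravariant_functor.intro C.category D.category contravariant_functor_axioms.intro)
    fix x y z f g
    assume x: "x \<in> Obj D"
    then show "obj_map G x \<in> Obj C" by (simp add: G_def A)
    show "arr_map G x x (Id D x) = Id C (obj_map G x)"
      using x by (intro C.act_eqI[of "A x" "A x"])
        (simp_all add: G_arr D.Id_eq C.act_Id mem, simp_all add: G_def C.Id_Hom mem C.act_Id)
    assume y: "y \<in> Obj D" and f: "f \<in> Hom D x y"
    then have f': "f \<in> u x \<rightarrow>\<^sub>E u y" using x by (simp add: D.Hom_eq)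
    show "arr_map G x y f \<in> Hom C (obj_map G y) (obj_map G x)"
      using G_arr(1)[OF x y f'] by (simp add: G_def)
    assume z: "z \<in> Obj D" and g: "g \<in> Hom D y z"
    then have g': "g \<in> u y \<rightarrow>\<^sub>E u z" using y by (simp add: D.Hom_eq)
    have gf: "compose (u x) g f \<in> u x \<rightarrow>\<^sub>E u z" using f' g' by (auto simp: compose_def)
    have "obj_map G = A" by (simp add: G_def)
    then show "arr_map G x z (Comp D x y z g f) =
        Comp C (obj_map G z) (obj_map G y) (obj_map G x) (arr_map G x y f) (arr_map G y z g)"
      using x y z f' g' gf PiE_mem[OF f'] by (intro C.act_eqI[of "A z" "A x"])
        (simp_all add: D.Comp_eq G_arr C.Comp_Hom C.act_Comp mem, simp_all add: compose_def mem)
  qed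
  have "naturally_isomorphic C C (contra_compose G F) identity_functor"
  proof -
    \<comment> \<open>An arrow from \<open>A (X a)\<close> to \<open>a\<close> acts backwards, from
      \<open>P a\<close> through \<open>u (X a)\<close> to \<open>P (A (X a))\<close>; hence
      \<open>e'\<close> followed by \<open>d\<close>.\<close>
    define \<eta> where "\<eta> a = C.lift (A (X a)) a (\<lambda>p. d (X a) (e' a p))" for a
    define \<eta>' where "\<eta>' a = C.lift a (A (X a)) (\<lambda>p. e a (d' (X a) p))" for a
    have \<eta>: "\<eta> a \<in> Hom C (A (X a)) a" "act (A (X a)) a (\<eta> a) = (\<lambda>p \<in> P a. d (X a) (e' a p))"
      and \<eta>': "\<eta>' a \<in> Hom C a (A (X a))"
        "act a (A (X a)) (\<eta>' a) = (\<lambda>p \<in> P (A (X a)). e a (d' (X a) p))"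
      if "a \<in> Obj C" for a
      using that by (auto simp: \<eta>_def \<eta>'_def mem intro!: C.lift_Hom C.act_lift)
    have iso: "is_iso C (A (X a)) a (\<eta> a)" if a: "a \<in> Obj C" for a
    proof -
      have "Comp C (A (X a)) a (A (X a)) (\<eta>' a) (\<eta> a) = Id C (A (X a))"
        using a by (intro C.act_eqI[of "A (X a)" "A (X a)"])
          (simp_all add: C.Comp_Hom C.Id_Hom C.act_Comp C.act_Id \<eta> \<eta>' mem compose_def)
      moreover have "Comp C a (A (X a)) a (\<eta> a) (\<eta>' a) = Id C a"
        using a by (intro C.act_eqI[of a a])
          (simp_all add: C.Comp_Hom C.Id_Hom C.act_Comp C.act_Id \<eta> \<eta>' mem compose_def)
      ultimately show ?thesis using \<eta>(1) \<eta>'(1) a by (auto simp: is_iso_def)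
    qed
    have nat: "Comp C (A (X a)) (A (X b)) b (\<eta> b) (arr_map G (X b) (X a) (arr_map F a b f)) =
        Comp C (A (X a)) a b f (\<eta> a)"
      if a: "a \<in> Obj C" and b: "b \<in> Obj C" and f: "f \<in> Hom C a b" for a b f
    proof -
      have Ff: "arr_map F a b f \<in> u (X b) \<rightarrow>\<^sub>E u (X a)"
        using a b f by (auto simp: F_def mem)
      have "arr_map F a b f t = e' a (act a b f (e b t))" if "t \<in> u (X b)" for t
        using that by (simp add: F_def)
      then show ?thesis
        using a b f Ff by (intro C.act_eqI[of "A (X a)" b])
          (simp_all add: C.Comp_Hom C.act_Comp G_arr \<eta> mem compose_def)
    qed
    show ?thesis
      unfolding naturally_isomorphic_def contra_compose_def identity_functor_def
      using iso nat by (intro exI[of _ \<eta>]) (simp add: F_def G_def)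
  qed
  moreover have "naturally_isomorphic D D (contra_compose F G) identity_functor"
  proof -
    \<comment> \<open>On the side of \<open>D\<close> arrows are functions, so the bijection from
      \<open>u (X (A x))\<close> through \<open>P (A x)\<close> to \<open>u x\<close> serves
      directly, without lifting.\<close>
    define \<theta> where "\<theta> x = (\<lambda>t \<in> u (X (A x)). d' x (e (A x) t))" for x
    define \<theta>' where "\<theta>' x = (\<lambda>t \<in> u x. e' (A x) (d x t))" for x
    have iso: "is_iso D (X (A x)) x (\<theta> x)" if x: "x \<in> Obj D" for x
      unfolding is_iso_def using x
      by (intro conjI bexI[of _ "\<theta>' x"])
        (auto simp: \<theta>_def \<theta>'_def D.Hom_eq D.Comp_eq D.Id_eq compose_def mem)
    have nat: "compose (u (X (A x))) (\<theta> y) (arr_map F (A y) (A x) (arr_map G x y g)) =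
        compose (u (X (A x))) g (\<theta> x)"
      if x: "x \<in> Obj D" and y: "y \<in> Obj D" and g: "g \<in> u x \<rightarrow>\<^sub>E u y" for x y g
      using that PiE_mem[OF g]
      by (auto simp: F_def G_arr \<theta>_def compose_def mem intro!: restrict_ext)
    show ?thesis
      unfolding naturally_isomorphic_def contra_compose_def identity_functor_def
      using iso nat by (intro exI[of _ \<theta>]) (simp add: F_def G_def D.Comp_eq D.Hom_eq mem)
  qed
  ultimately show ?thesis
    unfolding dually_equivalent_def using F G C.category D.category by blast
qed

text \<open>Continuity is automatic on a discrete source, so continuous maps are arbitrary functions
  between the underlying sets.\<close>

lemma concrete_category_discrete_spaces: "concrete_category (discrete_spaces V) topspace"
proof
  fix T T' :: "'a topology"
  assume "T \<in> Obj (discrete_spaces V)" "T' \<in> Obj (discrete_spaces V)"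
  then have "T = discrete_topology (topspace T)" "T' = discrete_topology (topspace T')"
    by (auto simp: discrete_spaces_def)
  then have "continuous_map T T' f \<longleftrightarrow> f \<in> topspace T \<rightarrow> topspace T'" for f
    by (metis continuous_map_from_discrete_topology)
  then show "Hom (discrete_spaces V) T T' = topspace T \<rightarrow>\<^sub>E topspace T'"
    by (auto simp: discrete_spaces_def PiE_def)
qed (auto simp: discrete_spaces_def)

lemma concrete_category_sets_category: "concrete_category (sets_category V) (\<lambda>X. X)"
  by unfold_locales (auto simp: sets_category_def)

section \<open>Atoms of complete atomic Boolean algebras\<close>

lemma (in boolean_lattice) complement_closed: "x \<in> carrier L \<Longrightarrow> complement L x \<in> carrier L"
  using complement_is_complement by (simp add: is_complement_def)

lemma boole_hom_compose:
  assumes A: "boolean_lattice A" and f: "f \<in> boole_hom A B" and g: "g \<in> boole_hom B C"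
  shows "compose (carrier A) g f \<in> boole_hom A C"
proof -
  interpret A: boolean_lattice A by fact
  have "f x \<in> carrier B" if "x \<in> carrier A" for x using f that by (auto simp: boole_hom_def)
  then show ?thesis
    using f g unfolding boole_hom_def
    by (auto simp: compose_def A.complement_closed)
qed

lemma boole_hom_id:
  assumes "boolean_lattice A" shows "(\<lambda>a \<in> carrier A. a) \<in> boole_hom A A"
proof -
  interpret A: boolean_lattice A by fact
  show ?thesis by (simp add: boole_hom_def A.complement_closed)
qed

locale caba_algebra = boolean_lattice B + complete: complete_lattice B for B :: "'a gorder" (structure) +
  assumes atomic: "\<lbrakk>b \<in> carrier B; b \<noteq> \<bottom>\<rbrakk> \<Longrightarrow> \<exists>x \<in> atoms B. x \<sqsubseteq> b"

lemma caba_iff: "caba B \<longleftrightarrow> caba_algebra B"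
  by (auto simp: caba_def caba_algebra_def caba_algebra_axioms_def)

context caba_algebra
begin

lemma atom_le_inf:
  assumes "x \<in> atoms B" "S \<subseteq> carrier B"
  shows "x \<sqsubseteq> \<Sqinter>S \<longleftrightarrow> (\<forall>s \<in> S. x \<sqsubseteq> s)"
proof -
  have x: "x \<in> carrier B" using assms(1) by (simp add: atoms_def)
  have "x \<sqsubseteq> s" if "x \<sqsubseteq> \<Sqinter>S" "s \<in> S" for s
    using that(1) complete.inf_lower[OF assms(2) that(2)]
    by (rule le_trans) (use x assms(2) that in auto)
  then show ?thesis using complete.inf_greatest[OF assms(2) x] by blast
qed

text \<open>Atoms are completely prime: if \<open>x\<close> is below no member of \<open>S\<close>,
  its complement is an upper bound of \<open>S\<close>, so \<open>x\<close> below the supremum would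
  be below its own complement.\<close>

lemma atom_le_sup:
  assumes x: "x \<in> atoms B" and S: "S \<subseteq> carrier B"
  shows "x \<sqsubseteq> \<Squnion>S \<longleftrightarrow> (\<exists>s \<in> S. x \<sqsubseteq> s)"
proof
  have xc: "x \<in> carrier B" using x by (simp add: atoms_def)
  assume le: "x \<sqsubseteq> \<Squnion>S"
  show "\<exists>s \<in> S. x \<sqsubseteq> s"
  proof (rule ccontr)
    assume n: "\<not> ?thesis"
    have "s \<sqsubseteq> complement B x" if "s \<in> S" for s
      using complement_le[OF complement_is_complement[OF xc], of s] that n S xc atom_meet[OF x, of s]
      by (auto simp: meet_comm)
    then have "\<Squnion>S \<sqsubseteq> complement B x"
      using S xc by (intro complete.sup_least) (auto simp: complement_closed)
    with le have "x \<sqsubseteq> complement B x"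
      by (rule le_trans) (use xc S complement_closed in auto)
    then show False using x xc by (simp add: atom_le_complement)
  qed
next
  have xc: "x \<in> carrier B" using x by (simp add: atoms_def)
  assume "\<exists>s \<in> S. x \<sqsubseteq> s"
  then obtain s where s: "s \<in> S" "x \<sqsubseteq> s" by blast
  show "x \<sqsubseteq> \<Squnion>S"
    using s(2) complete.sup_upper[OF S s(1)] by (rule le_trans) (use xc S s in auto)
qed

text \<open>Atomicity enters here: an atom under the meet of \<open>a\<close> with the complement of
  \<open>b\<close> would be below \<open>a\<close> but not below \<open>b\<close>, so that meet is
  bottom.\<close>

lemma le_if_atoms_le:
  assumes a: "a \<in> carrier B" and b: "b \<in> carrier B"
    and le: "\<And>x. x \<in> atoms B \<Longrightarrow> x \<sqsubseteq> a \<Longrightarrow> x \<sqsubseteq> b"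
  shows "a \<sqsubseteq> b"
proof -
  let ?c = "complement B b"
  have c: "?c \<in> carrier B" using b by (rule complement_closed)
  have "a \<sqinter> ?c = \<bottom>"
  proof (rule ccontr)
    assume "a \<sqinter> ?c \<noteq> \<bottom>"
    then obtain x where "x \<in> atoms B" "x \<sqsubseteq> a \<sqinter> ?c"
      using atomic[OF meet_closed[OF a c]] by blast
    then have "x \<sqsubseteq> a" "\<not> x \<sqsubseteq> b" using a b c by (simp_all add: atom_le_meet atom_le_complement)
    then show False using le \<open>x \<in> atoms B\<close> by blast
  qed
  \<comment> \<open>Reading \<open>b\<close> as a complement of \<open>?c\<close> lets
    \<open>complement_le\<close> turn disjointness of \<open>a\<close> and \<open>?c\<close> into
    \<open>a\<close> below \<open>b\<close>.\<close>
  moreover have "is_complement B ?c b"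
    using complement_is_complement[OF b] b join_comm[of B b ?c] meet_comm[of B b ?c]
    unfolding is_complement_def by metis
  ultimately show ?thesis using complement_le a c by blast
qed

lemma atom_point: "x \<in> atoms B \<Longrightarrow> (\<lambda>b \<in> carrier B. x \<sqsubseteq> b) \<in> atom_points B"
  by (simp add: atom_points_def)

lemma le_iff_points:
  assumes "a \<in> carrier B" "b \<in> carrier B"
  shows "a \<sqsubseteq> b \<longleftrightarrow> (\<forall>p \<in> atom_points B. p a \<longrightarrow> p b)"
proof
  assume "a \<sqsubseteq> b"
  then show "\<forall>p \<in> atom_points B. p a \<longrightarrow> p b"
    using assms by (auto simp: atom_points_def atoms_def intro: le_trans)
next
  assume p: "\<forall>p \<in> atom_points B. p a \<longrightarrow> p b"
  show "a \<sqsubseteq> b"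
    by (rule le_if_atoms_le[OF assms]) (use assms bspec[OF p atom_point] in simp)
qed

text \<open>Turns identities in the algebra into propositional equivalences, one for each
  point.\<close>

lemma points_eqI:
  "\<lbrakk>a \<in> carrier B; b \<in> carrier B; \<And>p. p \<in> atom_points B \<Longrightarrow> p a \<longleftrightarrow> p b\<rbrakk> \<Longrightarrow> a = b"
  by (rule le_antisym) (metis le_iff_points)+

lemma point_hom: "p \<in> atom_points B \<Longrightarrow> p \<in> boole_hom B two"
  using atom_points_subset caba_algebra_axioms caba_iff by blast

text \<open>Points of atoms preserve arbitrary suprema and infima. The last two parts express this;
  a general homomorphism into \<open>two\<close> preserves only the finite ones.\<close>

lemma point_simps:
  assumes "p \<in> atom_points B"
  shows "\<lbrakk>a \<in> carrier B; b \<in> carrier B\<rbrakk> \<Longrightarrow> p (a \<squnion> b) \<longleftrightarrow> p a \<or> p b"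
    and "\<lbrakk>a \<in> carrier B; b \<in> carrier B\<rbrakk> \<Longrightarrow> p (a \<sqinter> b) \<longleftrightarrow> p a \<and> p b"
    and "a \<in> carrier B \<Longrightarrow> p (complement B a) \<longleftrightarrow> \<not> p a"
    and "\<not> p \<bottom>" and "p \<top>"
    and "S \<subseteq> carrier B \<Longrightarrow> p (\<Squnion>S) \<longleftrightarrow> (\<exists>s \<in> S. p s)"
    and "S \<subseteq> carrier B \<Longrightarrow> p (\<Sqinter>S) \<longleftrightarrow> (\<forall>s \<in> S. p s)"
  using assms point_hom[OF assms]
  by (auto simp: boole_hom_def atom_points_def atom_le_sup atom_le_inf subset_iff)

text \<open>Here \<open>T\<close> may contain functions that are not points, so it can be given by a
  bare comprehension such as \<open>{p. f p b}\<close>.\<close>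

lemma ex_point_set: "\<exists>a \<in> carrier B. \<forall>p \<in> atom_points B. p a \<longleftrightarrow> p \<in> T"
proof -
  obtain a where a: "a \<in> carrier B" "T \<inter> atom_points B = atom_points B \<inter> stone_set B a"
    using atom_points_separate[of B "T \<inter> atom_points B"] caba_algebra_axioms caba_iff by auto
  then show ?thesis
    using point_hom by (intro bexI[of _ a]) (auto simp: stone_set_def)
qed

text \<open>A filter containing an atom is decided by it: the meet of \<open>y\<close> and
  \<open>b\<close> is either \<open>y\<close> or bottom, and evaluating \<open>g\<close> there
  determines \<open>g b\<close>.\<close>

lemma hom_two_eq_atom_point:
  assumes g: "g \<in> boole_hom B two" and y: "y \<in> atoms B" "g y"
  shows "g = (\<lambda>b \<in> carrier B. y \<sqsubseteq> b)"
proof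
  fix b
  have yc: "y \<in> carrier B" using y by (simp add: atoms_def)
  have g': "g (a \<sqinter> b) = (g a \<and> g b)" "\<not> g \<bottom>" if "a \<in> carrier B" "b \<in> carrier B" for a b
    using g that by (auto simp: boole_hom_def)
  show "g b = (\<lambda>b \<in> carrier B. y \<sqsubseteq> b) b"
  proof (cases "b \<in> carrier B")
    case True
    then show ?thesis using g'[OF yc True] y yc atom_meet[OF y(1) True] le_iff_join[OF yc True]
      by (metis restrict_apply')
  next
    case False
    then show ?thesis using g by (auto simp: boole_hom_def PiE_def extensional_def)
  qed
qed

text \<open>Elements are told apart by the atoms below them, and a set of atoms is recovered from
  its supremum. This is the size relation that \<open>power_matched\<close> refers to.\<close>

lemma carrier_eqpoll_Pow: "carrier B \<approx> Pow (atoms B)"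
proof -
  have "bij_betw (\<lambda>b. {x \<in> atoms B. x \<sqsubseteq> b}) (carrier B) (Pow (atoms B))"
  proof (rule bij_betw_imageI)
    show "inj_on (\<lambda>b. {x \<in> atoms B. x \<sqsubseteq> b}) (carrier B)"
    proof (rule inj_onI)
      fix a b
      assume ab: "a \<in> carrier B" "b \<in> carrier B"
        and eq: "{x \<in> atoms B. x \<sqsubseteq> a} = {x \<in> atoms B. x \<sqsubseteq> b}"
      have "x \<sqsubseteq> a \<longleftrightarrow> x \<sqsubseteq> b" if "x \<in> atoms B" for x
        using eq that by (metis (mono_tags, lifting) mem_Collect_eq)
      then show "a = b" using ab by (metis le_antisym le_if_atoms_le)
    qed
    have sup: "S = {x \<in> atoms B. x \<sqsubseteq> \<Squnion>S}" if "S \<subseteq> atoms B" for S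
    proof -
      have S: "S \<subseteq> carrier B" using that by (auto simp: atoms_def)
      \<comment> \<open>By complete primeness \<open>x\<close> lies below some \<open>s\<close> in
        \<open>S\<close>; an atom below an atom is equal to it.\<close>
      have "x \<in> S" if x: "x \<in> atoms B" "x \<sqsubseteq> \<Squnion>S" for x
      proof -
        obtain s where "s \<in> S" "x \<sqsubseteq> s" using x atom_le_sup[OF x(1) S] by blast
        then show ?thesis using x(1) \<open>S \<subseteq> atoms B\<close> by (auto simp: atoms_def)
      qed
      then have "x \<in> S \<longleftrightarrow> x \<in> atoms B \<and> x \<sqsubseteq> \<Squnion>S" for x
        using that complete.sup_upper[OF S] by (metis subsetD)
      then show ?thesis by (simp add: set_eq_iff)
    qed
    have sup_mem: "\<Squnion>S \<in> carrier B" if "S \<subseteq> atoms B" for S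
      using that by (intro complete.weak.sup_closed) (auto simp: atoms_def)
    show "(\<lambda>b. {x \<in> atoms B. x \<sqsubseteq> b}) ` carrier B = Pow (atoms B)"
    proof
      show "Pow (atoms B) \<subseteq> (\<lambda>b. {x \<in> atoms B. x \<sqsubseteq> b}) ` carrier B"
      proof
        fix S assume "S \<in> Pow (atoms B)"
        then have "S \<subseteq> atoms B" by simp
        from sup[OF this] sup_mem[OF this]
        show "S \<in> (\<lambda>b. {x \<in> atoms B. x \<sqsubseteq> b}) ` carrier B" by (rule image_eqI)
      qed
    qed auto
  qed
  then show ?thesis unfolding eqpoll_def by blast
qed

text \<open>Needed because \<open>power_matched\<close> concerns subsets of the carrier, hence
  atoms, while the functor uses points. Evaluating two equal points at both atoms gives the two
  inequalities.\<close>

lemma atom_points_eqpoll: "atoms B \<approx> atom_points B"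
proof -
  have "inj_on (\<lambda>x. \<lambda>b \<in> carrier B. x \<sqsubseteq> b) (atoms B)"
  proof (rule inj_onI)
    fix x y assume x: "x \<in> atoms B" "y \<in> atoms B"
      and eq: "(\<lambda>b \<in> carrier B. x \<sqsubseteq> b) = (\<lambda>b \<in> carrier B. y \<sqsubseteq> b)"
    then have "x \<in> carrier B" "y \<in> carrier B" by (auto simp: atoms_def)
    then show "x = y" using fun_cong[OF eq, of x] fun_cong[OF eq, of y] by (simp add: le_antisym)
  qed
  then show ?thesis unfolding atom_points_def eqpoll_def by (auto simp: bij_betw_def)
qed

end

section \<open>Homomorphisms described by their action on points\<close>

text \<open>If \<phi> is complete, it sends the supremum of all atoms to top, so a point
  \<open>p\<close> is true at \<phi> of some atom, and composing \<open>p\<close> with \<phi> gives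
  the point of that atom. Conversely, points preserve all suprema and infima and separate elements,
  so \<phi> inherits preservation.\<close>

lemma complete_boole_hom_iff_points:
  assumes B: "caba B" and B': "caba B'" and \<phi>: "\<phi> \<in> boole_hom B B'"
  shows "\<phi> \<in> complete_boole_hom B B' \<longleftrightarrow>
    (\<forall>p \<in> atom_points B'. compose (carrier B) p \<phi> \<in> atom_points B)"
proof
  interpret B: caba_algebra B using B caba_iff by blast
  interpret B': caba_algebra B' using B' caba_iff by blast
  have \<phi>_closed: "\<phi> b \<in> carrier B'" if "b \<in> carrier B" for b
    using \<phi> that by (auto simp: boole_hom_def)
  {
    assume c: "\<phi> \<in> complete_boole_hom B B'"
    show "\<forall>p \<in> atom_points B'. compose (carrier B) p \<phi> \<in> atom_points B"
    proof
      fix p assume p: "p \<in> atom_points B'"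
      have at: "atoms B \<subseteq> carrier B" by (auto simp: atoms_def)
      \<comment> \<open>This is the only supremum whose preservation the forward direction
        uses.\<close>
      have "\<Squnion>\<^bsub>B\<^esub>atoms B = \<top>\<^bsub>B\<^esub>"
      proof (rule B.le_antisym)
        show "\<top>\<^bsub>B\<^esub> \<sqsubseteq>\<^bsub>B\<^esub> \<Squnion>\<^bsub>B\<^esub>atoms B"
          by (rule B.le_if_atoms_le)
            (rule B.top_closed B.complete.weak.sup_closed[OF at] B.complete.sup_upper[OF at] | assumption)+
      qed (simp_all add: at)
      moreover have "\<phi> (\<Squnion>\<^bsub>B\<^esub>atoms B) = \<Squnion>\<^bsub>B'\<^esub>(\<phi> ` atoms B)"
        using c at by (simp add: complete_boole_hom_def sup_pres_def)
      moreover have "\<phi> \<top>\<^bsub>B\<^esub> = \<top>\<^bsub>B'\<^esub>" using \<phi> by (simp add: boole_hom_def)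
      ultimately have "p (\<Squnion>\<^bsub>B'\<^esub>(\<phi> ` atoms B))" using B'.point_simps(5)[OF p] by simp
      then obtain y where y: "y \<in> atoms B" "p (\<phi> y)"
        using B'.point_simps(6)[OF p, of "\<phi> ` atoms B"] at \<phi>_closed by auto
      have "compose (carrier B) p \<phi> \<in> boole_hom B two"
        using boole_hom_compose[OF B.boolean_lattice_axioms \<phi> B'.point_hom[OF p]] .
      then have "compose (carrier B) p \<phi> = (\<lambda>b \<in> carrier B. y \<sqsubseteq>\<^bsub>B\<^esub> b)"
        using y at by (intro B.hom_two_eq_atom_point) (auto simp: compose_def)
      then show "compose (carrier B) p \<phi> \<in> atom_points B" using B.atom_point[OF y(1)] by simp
    qed
  next
    assume p: "\<forall>p \<in> atom_points B'. compose (carrier B) p \<phi> \<in> atom_points B"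
    have "\<phi> (\<Squnion>\<^bsub>B\<^esub>S) = \<Squnion>\<^bsub>B'\<^esub>(\<phi> ` S)" "\<phi> (\<Sqinter>\<^bsub>B\<^esub>S) = \<Sqinter>\<^bsub>B'\<^esub>(\<phi> ` S)" if S: "S \<subseteq> carrier B" for S
    proof -
      have S': "\<phi> ` S \<subseteq> carrier B'" using S \<phi>_closed by auto
      have c: "p (\<phi> b) = compose (carrier B) p \<phi> b" if "b \<in> carrier B" for b p
        using that by (simp add: compose_def)
      have c': "p (\<phi> b) = compose (carrier B) p \<phi> b" if "b \<in> S" for b p
        using that S by (auto simp: compose_def)
      \<comment> \<open>Both sides become the same quantified statement over \<open>S\<close>: on
        the right because \<open>q\<close> is a point of \<open>B'\<close>, on the left because
        \<open>q\<close> composed with \<phi> is a point of \<open>B\<close>.\<close>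
      have "q (\<phi> (\<Squnion>\<^bsub>B\<^esub>S)) = q (\<Squnion>\<^bsub>B'\<^esub>(\<phi> ` S))" "q (\<phi> (\<Sqinter>\<^bsub>B\<^esub>S)) = q (\<Sqinter>\<^bsub>B'\<^esub>(\<phi> ` S))"
        if q: "q \<in> atom_points B'" for q
        using S B'.point_simps(6,7)[OF q S'] B.point_simps(6,7)[OF bspec[OF p q] S] c[of _ q] c'[of _ q]
        by simp_all
      then show "\<phi> (\<Squnion>\<^bsub>B\<^esub>S) = \<Squnion>\<^bsub>B'\<^esub>(\<phi> ` S)" "\<phi> (\<Sqinter>\<^bsub>B\<^esub>S) = \<Sqinter>\<^bsub>B'\<^esub>(\<phi> ` S)"
        using S S' by (auto intro!: B'.points_eqI \<phi>_closed)
    qed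
    then show "\<phi> \<in> complete_boole_hom B B'"
      using \<phi> B B' by (auto simp: complete_boole_hom_def sup_pres_def inf_pres_def caba_def)
  }
qed

text \<open>\<phi> is inverse image along \<open>f\<close>: the points of \<phi> \<open>b\<close>
  are those \<open>p\<close> for which \<open>f p\<close> is a point of \<open>b\<close>. Inverse
  images respect the Boolean operations.\<close>

lemma ex_hom_of_points:
  assumes B: "caba B" and B': "caba B'" and f: "f \<in> atom_points B' \<rightarrow>\<^sub>E atom_points B"
  shows "\<exists>\<phi> \<in> boole_hom B B'. \<forall>p \<in> atom_points B'. compose (carrier B) p \<phi> = f p"
proof -
  interpret B: caba_algebra B using B caba_iff by blast
  interpret B': caba_algebra B' using B' caba_iff by blast
  have fp: "f p \<in> atom_points B" if "p \<in> atom_points B'" for p using f that by auto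
  have "\<exists>b' \<in> carrier B'. \<forall>p \<in> atom_points B'. p b' \<longleftrightarrow> f p b" for b
    using B'.ex_point_set[of "{p. f p b}"] by simp
  then obtain h where h: "h b \<in> carrier B'" "\<And>p. p \<in> atom_points B' \<Longrightarrow> p (h b) \<longleftrightarrow> f p b" for b
    by metis
  define \<phi> where "\<phi> = restrict h (carrier B)"
  have "\<phi> \<in> boole_hom B B'"
  proof -
    have \<phi>_closed: "\<phi> b \<in> carrier B'" if "b \<in> carrier B" for b
      using that h(1) by (simp add: \<phi>_def)
    have p\<phi>: "p (\<phi> b) \<longleftrightarrow> f p b" if "p \<in> atom_points B'" "b \<in> carrier B" for p b
      using that h(2) by (simp add: \<phi>_def)
    have "\<phi> (a \<squnion>\<^bsub>B\<^esub> b) = \<phi> a \<squnion>\<^bsub>B'\<^esub> \<phi> b" "\<phi> (a \<sqinter>\<^bsub>B\<^esub> b) = \<phi> a \<sqinter>\<^bsub>B'\<^esub> \<phi> b"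
      if ab: "a \<in> carrier B" "b \<in> carrier B" for a b
      by (rule B'.points_eqI; simp add: \<phi>_closed ab p\<phi>
          B'.point_simps(1,2)[OF _ \<phi>_closed[OF ab(1)] \<phi>_closed[OF ab(2)]]
          B.point_simps(1,2)[OF fp ab])+
    moreover have "\<phi> (complement B a) = complement B' (\<phi> a)" if a: "a \<in> carrier B" for a
      by (rule B'.points_eqI; simp add: \<phi>_closed a p\<phi> B.complement_closed B'.complement_closed
          B'.point_simps(3)[OF _ \<phi>_closed[OF a]] B.point_simps(3)[OF fp a])
    moreover have "\<phi> \<bottom>\<^bsub>B\<^esub> = \<bottom>\<^bsub>B'\<^esub>"
      by (rule B'.points_eqI; simp add: \<phi>_closed p\<phi> B'.point_simps(4) B.point_simps(4)[OF fp])
    moreover have "\<phi> \<top>\<^bsub>B\<^esub> = \<top>\<^bsub>B'\<^esub>"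
      by (rule B'.points_eqI; simp add: \<phi>_closed p\<phi> B'.point_simps(5) B.point_simps(5)[OF fp])
    moreover have "\<phi> \<in> carrier B \<rightarrow>\<^sub>E carrier B'"
      using \<phi>_closed by (simp add: \<phi>_def)
    ultimately show ?thesis unfolding boole_hom_def by blast
  qed
  moreover have "compose (carrier B) p \<phi> = f p" if p: "p \<in> atom_points B'" for p
  proof
    \<comment> \<open>Off the carrier both sides are \<open>undefined\<close>, as \<open>f p\<close>
      is extensional.\<close>
    fix b
    show "compose (carrier B) p \<phi> b = f p b"
      using B.point_hom[OF fp[OF p]] h(2)[OF p]
      by (auto simp: compose_def \<phi>_def boole_hom_def PiE_def extensional_def)
  qed
  ultimately show ?thesis by blast
qed

lemma hom_eq_if_points_eq:
  assumes "caba B'" "\<phi> \<in> boole_hom B B'" "\<psi> \<in> boole_hom B B'"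
    and eq: "\<And>p. p \<in> atom_points B' \<Longrightarrow> compose (carrier B) p \<phi> = compose (carrier B) p \<psi>"
  shows "\<phi> = \<psi>"
proof (rule PiE_ext)
  interpret B': caba_algebra B' using assms(1) caba_iff by blast
  show \<phi>: "\<phi> \<in> carrier B \<rightarrow>\<^sub>E carrier B'" and \<psi>: "\<psi> \<in> carrier B \<rightarrow>\<^sub>E carrier B'"
    using assms by (auto simp: boole_hom_def)
  fix b assume b: "b \<in> carrier B"
  show "\<phi> b = \<psi> b"
  proof (rule B'.points_eqI)
    fix p assume "p \<in> atom_points B'"
    from fun_cong[OF eq[OF this], of b] show "p (\<phi> b) = p (\<psi> b)" using b by (simp add: compose_def)
  qed (use \<phi> \<psi> b in auto)
qed

section \<open>Power set algebras on arbitrary carriers\<close>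

text \<open>The order of the power set is pulled back along a bijection, because \<open>U\<close>
  supplies only some set of the right size. For empty \<open>X\<close> this is the one-element
  algebra, which has no atoms.\<close>

lemma powerset_algebra:
  fixes A :: "'a set" and X :: "'x set"
  assumes "A \<approx> Pow X"
  shows "\<exists>B. carrier B = A \<and> caba B \<and> X \<approx> atoms B"
proof -
  obtain g where g: "bij_betw g A (Pow X)" using assms by (auto simp: eqpoll_def)
  define B :: "'a gorder" where "B = \<lparr>carrier = A, eq = (=), le = (\<lambda>a b. g a \<subseteq> g b)\<rparr>"
  have [simp]: "carrier B = A" by (simp add: B_def)
  have le: "a \<sqsubseteq>\<^bsub>B\<^esub> b \<longleftrightarrow> g a \<subseteq> g b" for a b by (simp add: B_def)
  have g_eq: "a = b" if "a \<in> A" "b \<in> A" "g a = g b" for a b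
    using g that by (meson bij_betw_imp_inj_on inj_onD)
  have gX: "g a \<subseteq> X" if "a \<in> A" for a using g that by (auto dest: bij_betwE)
  define h where "h = inv_into A g"
  have h: "h S \<in> A" "g (h S) = S" if "S \<subseteq> X" for S
    using g that unfolding h_def
    by (auto simp: bij_betw_inv_into_right dest: bij_betw_inv_into bij_betwE)
  interpret partial_order B
    by unfold_locales (auto simp: B_def intro: g_eq)
  have lub: "least B (h (\<Union>(g ` S))) (Upper B S)" if S: "S \<subseteq> A" for S
  proof -
    have "\<Union>(g ` S) \<subseteq> X" using S gX by blast
    then show ?thesis using S h by (fastforce simp: least_def Upper_def le)
  qed
  \<comment> \<open>Intersecting with \<open>X\<close> handles empty \<open>S\<close>, whose bare
    intersection would be the whole type.\<close>
  have glb: "greatest B (h (X \<inter> \<Inter>(g ` S))) (Lower B S)" if S: "S \<subseteq> A" for S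
  proof -
    have "X \<inter> \<Inter>(g ` S) \<subseteq> X" by blast
    then show ?thesis using S h gX by (fastforce simp: greatest_def Lower_def le)
  qed
  interpret L: complete_lattice B
    by (rule complete_latticeI) (use lub glb in auto)
  interpret bounded_lattice B
    by unfold_locales
  \<comment> \<open>Once \<open>g\<close> is known to carry the operations to those of sets,
    \<open>g_eq\<close> reduces every law to a set identity.\<close>
  have g_sup: "g (\<Squnion>\<^bsub>B\<^esub>S) = \<Union>(g ` S)" if S: "S \<subseteq> A" for S
  proof -
    have "\<Squnion>\<^bsub>B\<^esub>S = h (\<Union>(g ` S))" using least_unique[OF L.sup_lub lub] S by simp
    then show ?thesis using h(2)[of "\<Union>(g ` S)"] S gX by auto
  qed
  have g_inf: "g (\<Sqinter>\<^bsub>B\<^esub>S) = X \<inter> \<Inter>(g ` S)" if S: "S \<subseteq> A" for S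
  proof -
    have "\<Sqinter>\<^bsub>B\<^esub>S = h (X \<inter> \<Inter>(g ` S))" using greatest_unique[OF L.inf_glb glb] S by simp
    then show ?thesis using h(2)[of "X \<inter> \<Inter>(g ` S)"] by auto
  qed
  have g_join: "g (a \<squnion>\<^bsub>B\<^esub> b) = g a \<union> g b" and g_meet: "g (a \<sqinter>\<^bsub>B\<^esub> b) = g a \<inter> g b"
    if "a \<in> A" "b \<in> A" for a b
    using that gX by (auto simp: join_def meet_def g_sup g_inf)
  have g_bot: "g \<bottom>\<^bsub>B\<^esub> = {}"
    using L.bottom_lower[of "h {}"] h[of "{}"] by (simp add: le)
  have g_top: "g \<top>\<^bsub>B\<^esub> = X"
    using L.top_higher[of "h X"] h[of X] gX[of "\<top>\<^bsub>B\<^esub>"] L.top_closed by (auto simp: le)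
  have cl: "\<lbrakk>a \<in> A; b \<in> A\<rbrakk> \<Longrightarrow> a \<squnion>\<^bsub>B\<^esub> b \<in> A" "\<lbrakk>a \<in> A; b \<in> A\<rbrakk> \<Longrightarrow> a \<sqinter>\<^bsub>B\<^esub> b \<in> A"
      "\<bottom>\<^bsub>B\<^esub> \<in> A" "\<top>\<^bsub>B\<^esub> \<in> A" for a b
    using L.join_closed L.meet_closed L.bottom_closed L.top_closed by auto
  have boolean: "boolean_lattice B"
  proof
    fix x y z assume "x \<in> carrier B" "y \<in> carrier B" "z \<in> carrier B"
    then show "x \<sqinter>\<^bsub>B\<^esub> (y \<squnion>\<^bsub>B\<^esub> z) = (x \<sqinter>\<^bsub>B\<^esub> y) \<squnion>\<^bsub>B\<^esub> (x \<sqinter>\<^bsub>B\<^esub> z)"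
      by (intro g_eq) (auto simp: cl g_join g_meet)
  next
    fix x assume x: "x \<in> carrier B"
    have "is_complement B x (h (X - g x))"
    proof -
      have c: "h (X - g x) \<in> A" "g (h (X - g x)) = X - g x" by (simp_all add: h)
      have "x \<squnion>\<^bsub>B\<^esub> h (X - g x) = \<top>\<^bsub>B\<^esub>"
        using x c gX[of x] by (intro g_eq) (auto simp: cl g_join g_top)
      moreover have "x \<sqinter>\<^bsub>B\<^esub> h (X - g x) = \<bottom>\<^bsub>B\<^esub>"
        using x c by (intro g_eq) (auto simp: cl g_meet g_bot)
      ultimately show ?thesis using c by (simp add: is_complement_def)
    qed
    then show "\<exists>y. is_complement B x y" ..
  qed
  have atom: "h {x} \<in> atoms B" if "x \<in> X" for x
  proof -
    have hx: "h {x} \<in> A" "g (h {x}) = {x}" using that by (simp_all add: h)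
    have "y = \<bottom>\<^bsub>B\<^esub> \<or> y = h {x}" if y: "y \<in> A" "g y \<subseteq> {x}" for y
    proof (cases "g y = {}")
      case True
      then show ?thesis using g_eq[OF y(1) cl(3)] g_bot by simp
    next
      case False
      then have "g y = g (h {x})" using hx(2) y(2) by (simp add: subset_singleton_iff)
      then show ?thesis using g_eq[OF y(1) hx(1)] by simp
    qed
    moreover have "h {x} \<noteq> \<bottom>\<^bsub>B\<^esub>" using hx(2) g_bot by (metis empty_not_insert)
    ultimately show ?thesis using hx unfolding atoms_def by (simp add: le)
  qed
  \<comment> \<open>Used twice: it gives atomicity, and applied to an atom it shows that the atom is
    some \<open>h {x}\<close>.\<close>
  have below: "\<exists>x \<in> X. h {x} \<sqsubseteq>\<^bsub>B\<^esub> b" if "b \<in> A" "b \<noteq> \<bottom>\<^bsub>B\<^esub>" for b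
  proof -
    have "g b \<noteq> {}" using that g_bot cl(3) g_eq by metis
    then obtain x where "x \<in> g b" by blast
    moreover have "x \<in> X" using gX[OF that(1)] calculation by (rule subsetD)
    ultimately show ?thesis using h[of "{x}"] by (intro bexI[of _ x]) (simp_all add: le)
  qed
  have "\<exists>x \<in> atoms B. x \<sqsubseteq>\<^bsub>B\<^esub> b" if "b \<in> carrier B" "b \<noteq> \<bottom>\<^bsub>B\<^esub>" for b
    using below[of b] that atom by (metis \<open>carrier B = A\<close>)
  then have caba: "caba B"
    by (simp add: caba_def boolean L.complete_lattice_axioms)
  have "bij_betw (\<lambda>x. h {x}) X (atoms B)"
  proof (rule bij_betw_imageI)
    show "inj_on (\<lambda>x. h {x}) X"
      using h(2) by (intro inj_onI) (metis empty_subsetI insert_subset singleton_insert_inj_eq)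
    have "a \<in> (\<lambda>x. h {x}) ` X" if a: "a \<in> atoms B" for a
    proof -
      obtain x where x: "x \<in> X" "h {x} \<sqsubseteq>\<^bsub>B\<^esub> a" using below[of a] a by (auto simp: atoms_def)
      then have "h {x} = a" using a atom[OF x(1)] by (auto simp: atoms_def)
      then show ?thesis using x by blast
    qed
    then show "(\<lambda>x. h {x}) ` X = atoms B" using atom by (intro equalityI) auto
  qed
  then show ?thesis using caba by (intro exI[of _ B]) (auto simp: eqpoll_def)
qed

section \<open>The four dualities\<close>

text \<open>\<phi> maps into the carrier of \<open>B\<close>, so the restriction in the inner
  composite has no effect.\<close>

lemma compose_assoc_points:
  assumes "\<phi> \<in> boole_hom A B" "p \<in> boole_hom C two"
  shows "compose (carrier A) p (compose (carrier A) \<psi> \<phi>) = compose (carrier A) (compose (carrier B) p \<psi>) \<phi>"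
  using assms by (auto simp: compose_def boole_hom_def fun_eq_iff)

lemma compose_id_point:
  assumes "p \<in> atom_points B"
  shows "compose (carrier B) p (\<lambda>b \<in> carrier B. b) = p"
  using assms by (auto simp: atom_points_def compose_def fun_eq_iff)

section \<open>T-algebras represented by their points\<close>

lemma Obj_TBoole: "(B, X) \<in> Obj (TBoole U) \<longleftrightarrow> carrier B \<in> U \<and> caba B \<and> X = atom_points B"
  by (simp add: TBoole_def full_subcategory_def boolean_T_algebra_def)

lemma Hom_TBoole:
  "m \<in> Hom (TBoole U) (A, X) (A', X') \<longleftrightarrow> fst m \<in> boole_hom A A' \<and> snd m \<in> X' \<rightarrow>\<^sub>E X \<and>
     (\<forall>x' \<in> X'. compose (carrier A) x' (fst m) = snd m x')"
  by (auto simp: TBoole_def full_subcategory_def dzBoole_def)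

lemma Id_TBoole: "Id (TBoole U) (A, X) = (\<lambda>a \<in> carrier A. a, \<lambda>x \<in> X. x)"
  by (simp add: TBoole_def full_subcategory_def dzBoole_def)

lemma Comp_TBoole:
  "Comp (TBoole U) (A, X) (A', X') (A'', X'') n m =
     (compose (carrier A) (fst n) (fst m), compose X'' (snd m) (snd n))"
  by (simp add: TBoole_def full_subcategory_def dzBoole_def split: prod.split)

text \<open>Objects store their points and arrows their maps of points, so second projections
  suffice. The content is the bijection: each map of points has exactly one accompanying
  homomorphism.\<close>

lemma dually_represented_TBoole: "dually_represented (TBoole U) snd (\<lambda>a b. snd)"
proof (unfold_locales, goal_cases)
  case (1 a)
  then obtain B where a: "a = (B, atom_points B)" and B: "caba B"
    by (cases a) (auto simp: Obj_TBoole)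
  then show ?case
    using boole_hom_id[of B] compose_id_point[of _ B]
    by (auto simp: Hom_TBoole Id_TBoole caba_def)
next
  case (2 a b c f g)
  then obtain A B C where a: "a = (A, atom_points A)" and A: "caba A"
    and b: "b = (B, atom_points B)" and c: "c = (C, atom_points C)" and C: "caba C"
    by (cases a, cases b, cases c) (auto simp: Obj_TBoole)
  have f: "fst f \<in> boole_hom A B" "snd f \<in> atom_points B \<rightarrow>\<^sub>E atom_points A"
      "\<And>p. p \<in> atom_points B \<Longrightarrow> compose (carrier A) p (fst f) = snd f p"
    and g: "fst g \<in> boole_hom B C" "snd g \<in> atom_points C \<rightarrow>\<^sub>E atom_points B"
      "\<And>p. p \<in> atom_points C \<Longrightarrow> compose (carrier B) p (fst g) = snd g p"
    using 2 by (simp_all add: a b c Hom_TBoole)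
  have "compose (carrier A) p (compose (carrier A) (fst g) (fst f)) = snd f (snd g p)"
    if "p \<in> atom_points C" for p
    using that f(3)[OF PiE_mem[OF g(2) that]] g(3)[OF that] atom_points_subset[OF C]
      compose_assoc_points[OF f(1), of p C "fst g"] by auto
  moreover have "compose (carrier A) (fst g) (fst f) \<in> boole_hom A C"
    using A f(1) g(1) by (intro boole_hom_compose) (auto simp: caba_def)
  ultimately show ?case
    using f(2) g(2) by (auto simp: a b c Hom_TBoole Comp_TBoole compose_def)
next
  case (3 a)
  then show ?case by (cases a) (simp add: Id_TBoole)
next
  case (4 a b c f g)
  then show ?case by (cases a, cases b, cases c) (simp add: Comp_TBoole)
next
  case (5 a b)
  then obtain A B where a: "a = (A, atom_points A)" and A: "caba A"
    and b: "b = (B, atom_points B)" and B: "caba B"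
    by (cases a, cases b) (auto simp: Obj_TBoole)
  show ?case
    unfolding a b snd_conv
  proof (rule bij_betw_imageI)
    let ?H = "Hom (TBoole U) (A, atom_points A) (B, atom_points B)"
    show "inj_on snd ?H"
    proof (rule inj_onI)
      fix f g assume f: "f \<in> ?H" and g: "g \<in> ?H" and eq: "snd f = snd g"
      then have "fst f = fst g"
        by (intro hom_eq_if_points_eq[OF B, of _ A]) (simp_all add: Hom_TBoole)
      then show "f = g" using eq by (rule prod_eqI)
    qed
    have "f \<in> snd ` ?H" if f: "f \<in> atom_points B \<rightarrow>\<^sub>E atom_points A" for f
    proof -
      obtain \<phi> where "\<phi> \<in> boole_hom A B" "\<forall>p \<in> atom_points B. compose (carrier A) p \<phi> = f p"
        using ex_hom_of_points[OF A B f] by blast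
      then have "(\<phi>, f) \<in> ?H" using f by (simp add: Hom_TBoole)
      then show ?thesis by force
    qed
    then show "snd ` ?H = atom_points B \<rightarrow>\<^sub>E atom_points A"
      by (auto simp: Hom_TBoole)
  qed
qed

section \<open>T-maps represented by their points\<close>

lemma Obj_TMaps:
  "(A, \<alpha>, B) \<in> Obj (TMaps U) \<longleftrightarrow>
     carrier B \<in> U \<and> caba B \<and> A = B \<and> \<alpha> = (\<lambda>b \<in> carrier B. b)"
  by (auto simp: TMaps_def full_subcategory_def boolean_T_map_def)

text \<open>Both objects are identity maps and \<phi>, \<sigma> are extensional, so the commuting
  square says exactly that they coincide.\<close>

lemma Hom_TMaps:
  assumes "(A, \<alpha>, B) \<in> Obj (TMaps U)" "(A', \<alpha>', B') \<in> Obj (TMaps U)"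
  shows "m \<in> Hom (TMaps U) (A, \<alpha>, B) (A', \<alpha>', B') \<longleftrightarrow>
    fst m = snd m \<and> snd m \<in> complete_boole_hom B B'"
proof -
  have "compose (carrier B) \<alpha>' \<phi> = compose (carrier B) \<sigma> \<alpha> \<longleftrightarrow> \<phi> = \<sigma>"
    if "\<phi> \<in> boole_hom B B'" "\<sigma> \<in> boole_hom B B'" for \<phi> \<sigma>
  proof -
    have "\<phi> \<in> carrier B \<rightarrow>\<^sub>E carrier B'" "\<sigma> \<in> carrier B \<rightarrow>\<^sub>E carrier B'"
      using that by (auto simp: boole_hom_def)
    then have "compose (carrier B) \<alpha>' \<phi> = \<phi>" "compose (carrier B) \<sigma> \<alpha> = \<sigma>"
      using assms by (auto simp: Obj_TMaps compose_def fun_eq_iff PiE_def extensional_def Pi_iff)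
    then show ?thesis by simp
  qed
  moreover have "A = B" "A' = B'" using assms by (simp_all add: Obj_TMaps)
  ultimately show ?thesis
    by (cases m) (auto simp: TMaps_def full_subcategory_def mzMaps_def complete_boole_hom_def)
qed

lemma Id_TMaps: "Id (TMaps U) (A, \<alpha>, B) = (\<lambda>a \<in> carrier A. a, \<lambda>b \<in> carrier B. b)"
  by (simp add: TMaps_def full_subcategory_def mzMaps_def)

lemma Comp_TMaps:
  "Comp (TMaps U) (A, \<alpha>, B) (A', \<alpha>', B') (A'', \<alpha>'', B'') n m =
     (compose (carrier A) (fst n) (fst m), compose (carrier B) (snd n) (snd m))"
  by (simp add: TMaps_def full_subcategory_def mzMaps_def split: prod.split)

text \<open>No map of points is stored here; an arrow acts by composing points with \<sigma>, and
  completeness is what keeps the result among atom points.\<close>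

lemma dually_represented_TMaps:
  "dually_represented (TMaps U) (\<lambda>(A, \<alpha>, B). atom_points B)
     (\<lambda>(A, \<alpha>, B) (A', \<alpha>', B') (\<phi>, \<sigma>). \<lambda>p \<in> atom_points B'. compose (carrier B) p \<sigma>)"
proof (unfold_locales, goal_cases)
  case (1 a)
  then obtain B where a: "a = (B, \<lambda>b \<in> carrier B. b, B)" and B: "caba B"
    by (cases a) (auto simp: Obj_TMaps)
  have "(\<lambda>b \<in> carrier B. b) \<in> complete_boole_hom B B"
    using B boole_hom_id[of B] compose_id_point[of _ B]
    by (subst complete_boole_hom_iff_points) (auto simp: caba_def)
  then show ?case using 1 by (simp add: a Hom_TMaps Id_TMaps)
next
  case (2 a b c f g)
  then obtain A B C where a: "a = (A, \<lambda>x \<in> carrier A. x, A)" and A: "caba A"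
    and b: "b = (B, \<lambda>x \<in> carrier B. x, B)" and B: "caba B"
    and c: "c = (C, \<lambda>x \<in> carrier C. x, C)" and C: "caba C"
    by (cases a, cases b, cases c) (auto simp: Obj_TMaps)
  have f: "fst f = snd f" "snd f \<in> complete_boole_hom A B"
    and g: "fst g = snd g" "snd g \<in> complete_boole_hom B C"
    using 2 by (simp_all add: a b c Hom_TMaps)
  have h: "snd f \<in> boole_hom A B" "snd g \<in> boole_hom B C"
    using f g by (auto simp: complete_boole_hom_def)
  have "compose (carrier A) (snd g) (snd f) \<in> boole_hom A C"
    using A h by (intro boole_hom_compose) (auto simp: caba_def)
  \<comment> \<open>Completeness of the composite is checked on points, avoiding suprema and
    infima.\<close>
  moreover have "compose (carrier A) p (compose (carrier A) (snd g) (snd f)) \<in> atom_points A"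
    if "p \<in> atom_points C" for p
  proof -
    have "compose (carrier B) p (snd g) \<in> atom_points B"
      using that g(2) h(2) B C by (simp add: complete_boole_hom_iff_points)
    then have "compose (carrier A) (compose (carrier B) p (snd g)) (snd f) \<in> atom_points A"
      using f(2) h(1) A B by (simp add: complete_boole_hom_iff_points)
    then show ?thesis
      using compose_assoc_points[OF h(1), of p C "snd g"] that atom_points_subset[OF C] by auto
  qed
  ultimately have "compose (carrier A) (snd g) (snd f) \<in> complete_boole_hom A C"
    using A C by (simp add: complete_boole_hom_iff_points)
  then show ?case using 2 f g by (simp add: a b c Hom_TMaps Comp_TMaps)
next
  case (3 a)
  then obtain B where a: "a = (B, \<lambda>b \<in> carrier B. b, B)" and B: "caba B"
    by (cases a) (auto simp: Obj_TMaps)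
  show ?case by (auto simp: a Id_TMaps compose_id_point)
next
  case (4 a b c f g)
  then obtain A B C where a: "a = (A, \<lambda>x \<in> carrier A. x, A)"
    and b: "b = (B, \<lambda>x \<in> carrier B. x, B)" and B: "caba B"
    and c: "c = (C, \<lambda>x \<in> carrier C. x, C)" and C: "caba C"
    by (cases a, cases b, cases c) (auto simp: Obj_TMaps)
  have f: "snd f \<in> boole_hom A B" and g: "snd g \<in> complete_boole_hom B C" "snd g \<in> boole_hom B C"
    using 4 by (simp_all add: a b c Hom_TMaps complete_boole_hom_def)
  have "compose (carrier B) p (snd g) \<in> atom_points B" if "p \<in> atom_points C" for p
    using that g B C by (simp add: complete_boole_hom_iff_points)
  moreover have "compose (carrier A) p (compose (carrier A) (snd g) (snd f)) =
      compose (carrier A) (compose (carrier B) p (snd g)) (snd f)" if "p \<in> atom_points C" for p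
    using compose_assoc_points[OF f] that atom_points_subset[OF C] by blast
  ultimately show ?case
    by (auto simp: a b c Comp_TMaps case_prod_beta compose_def[of "atom_points C"])
next
  case (5 a b)
  then obtain A B where a: "a = (A, \<lambda>x \<in> carrier A. x, A)" and A: "caba A"
    and b: "b = (B, \<lambda>x \<in> carrier B. x, B)" and B: "caba B"
    by (cases a, cases b) (auto simp: Obj_TMaps)
  let ?H = "Hom (TMaps U) (A, \<lambda>x \<in> carrier A. x, A) (B, \<lambda>x \<in> carrier B. x, B)"
  let ?act = "\<lambda>m. \<lambda>p \<in> atom_points B. compose (carrier A) p (snd m)"
  have H: "m \<in> ?H \<longleftrightarrow> fst m = snd m \<and> snd m \<in> complete_boole_hom A B" for m
    using 5 unfolding a b by (rule Hom_TMaps)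
  have "bij_betw ?act ?H (atom_points B \<rightarrow>\<^sub>E atom_points A)"
  proof (rule bij_betw_imageI)
    show "inj_on ?act ?H"
    proof (rule inj_onI)
      fix f g assume f: "f \<in> ?H" and g: "g \<in> ?H" and eq: "?act f = ?act g"
      have "compose (carrier A) p (snd f) = compose (carrier A) p (snd g)"
        if "p \<in> atom_points B" for p
        using fun_cong[OF eq, of p] that by simp
      then have "snd f = snd g"
        using f g by (intro hom_eq_if_points_eq[OF B, of _ A]) (simp_all add: H complete_boole_hom_def)
      then show "f = g" using f g by (intro prod_eqI) (simp_all add: H)
    qed
    have "?act m \<in> atom_points B \<rightarrow>\<^sub>E atom_points A" if "m \<in> ?H" for m
    proof -
      have "snd m \<in> complete_boole_hom A B" "snd m \<in> boole_hom A B"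
        using that by (simp_all add: H complete_boole_hom_def)
      then show ?thesis using A B by (simp add: complete_boole_hom_iff_points)
    qed
    moreover have "f \<in> ?act ` ?H" if f: "f \<in> atom_points B \<rightarrow>\<^sub>E atom_points A" for f
    proof -
      obtain \<phi> where \<phi>: "\<phi> \<in> boole_hom A B"
          "\<And>p. p \<in> atom_points B \<Longrightarrow> compose (carrier A) p \<phi> = f p"
        using ex_hom_of_points[OF A B f] by blast
      \<comment> \<open>Composition with \<phi> agrees with \<open>f\<close>, which takes values in
        points; this already makes \<phi> complete.\<close>
      then have "\<phi> \<in> complete_boole_hom A B"
        using A B f by (auto simp: complete_boole_hom_iff_points)
      then have "(\<phi>, \<phi>) \<in> ?H" by (simp add: H)
      moreover have "f = ?act (\<phi>, \<phi>)" using f \<phi>(2) by (auto simp: PiE_def extensional_def fun_eq_iff)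
      ultimately show ?thesis by (rule rev_image_eqI)
    qed
    ultimately show "?act ` ?H = atom_points B \<rightarrow>\<^sub>E atom_points A"
      by (intro equalityI image_subsetI subsetI)
  qed
  then show ?case by (simp add: a b case_prod_unfold)
qed

section \<open>Matching objects by cardinality\<close>

text \<open>The set of atoms is an admissible \<open>Y\<close> in the second clause of
  \<open>power_matched\<close>.\<close>

lemma power_matched_points:
  assumes "power_matched U V" "carrier B \<in> U" "caba B"
  shows "\<exists>X \<in> V. X \<approx> atom_points B"
proof -
  interpret caba_algebra B using assms(3) caba_iff by blast
  have "atoms B \<subseteq> carrier B" by (auto simp: atoms_def)
  then obtain X where "X \<in> V" "X \<approx> atoms B"
    using assms(1,2) carrier_eqpoll_Pow unfolding power_matched_def by blast
  then show ?thesis using atom_points_eqpoll eqpoll_trans by blast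
qed

lemma power_matched_algebra:
  assumes "power_matched U V" "X \<in> V"
  shows "\<exists>B. carrier B \<in> U \<and> caba B \<and> X \<approx> atom_points B"
proof -
  obtain A where "A \<in> U" "A \<approx> Pow X" using assms by (auto simp: power_matched_def)
  then obtain B where B: "carrier B \<in> U" "caba B" "X \<approx> atoms B"
    using powerset_algebra by metis
  interpret caba_algebra B using B(2) caba_iff by blast
  show ?thesis using B atom_points_eqpoll eqpoll_trans by blast
qed

theorem proposition6p1:
  fixes U :: "'a set set" and V :: "'x set set"
  assumes "power_matched U V"
  shows "dually_equivalent (TBoole U) (discrete_spaces V)
       \<and> dually_equivalent (TMaps U) (discrete_spaces V)
       \<and> dually_equivalent (TBoole U) (sets_category V)
       \<and> dually_equivalent (TMaps U) (sets_category V)"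
proof -
  \<comment> \<open>One argument for both targets: \<open>D\<close> enters only through its
    underlying sets, which make up exactly \<open>V\<close>.\<close>
  have TBoole: "dually_equivalent (TBoole U) D" and TMaps: "dually_equivalent (TMaps U) D"
    if D: "concrete_category D u" and u: "u ` Obj D = V"
    for D :: "('o, 'x \<Rightarrow> 'x) category_data" and u
  proof -
    have points: "\<exists>x \<in> Obj D. u x \<approx> atom_points B" if "carrier B \<in> U" "caba B" for B
      using power_matched_points[OF assms that] u by blast
    have algebra: "\<exists>B. carrier B \<in> U \<and> caba B \<and> u x \<approx> atom_points B" if "x \<in> Obj D" for x
      using power_matched_algebra[OF assms] u that by blast
    show "dually_equivalent (TBoole U) D"
    proof (rule dually_equivalent_points[OF dually_represented_TBoole D])
      show "\<exists>x \<in> Obj D. u x \<approx> snd a" if "a \<in> Obj (TBoole U)" for a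
        using that points by (cases a) (simp add: Obj_TBoole)
      show "\<exists>a \<in> Obj (TBoole U). u x \<approx> snd a" if x: "x \<in> Obj D" for x
      proof -
        obtain B where "carrier B \<in> U" "caba B" "u x \<approx> atom_points B" using algebra[OF x] by blast
        then show ?thesis by (intro bexI[of _ "(B, atom_points B)"]) (simp_all add: Obj_TBoole)
      qed
    qed
    show "dually_equivalent (TMaps U) D"
    proof (rule dually_equivalent_points[OF dually_represented_TMaps D])
      show "\<exists>x \<in> Obj D. u x \<approx> (case a of (A, \<alpha>, B) \<Rightarrow> atom_points B)" if "a \<in> Obj (TMaps U)" for a
        using that points by (cases a) (simp add: Obj_TMaps)
      show "\<exists>a \<in> Obj (TMaps U). u x \<approx> (case a of (A, \<alpha>, B) \<Rightarrow> atom_points B)" if x: "x \<in> Obj D" for x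
      proof -
        obtain B where "carrier B \<in> U" "caba B" "u x \<approx> atom_points B" using algebra[OF x] by blast
        then show ?thesis
          by (intro bexI[of _ "(B, \<lambda>b \<in> carrier B. b, B)"]) (simp_all add: Obj_TMaps)
      qed
    qed
  qed
  have discrete: "topspace ` Obj (discrete_spaces V) = V"
  proof
    show "V \<subseteq> topspace ` Obj (discrete_spaces V)"
    proof
      fix X assume "X \<in> V"
      then show "X \<in> topspace ` Obj (discrete_spaces V)"
        by (intro image_eqI[of _ _ "discrete_topology X"]) (simp_all add: discrete_spaces_def)
    qed
  qed (auto simp: discrete_spaces_def)
  have sets: "(\<lambda>X. X) ` Obj (sets_category V) = V" by (simp add: sets_category_def)
  note discrete = concrete_category_discrete_spaces discrete
    and sets = concrete_category_sets_category sets
  show ?thesis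
    by (intro conjI TBoole[OF discrete] TBoole[OF sets] TMaps[OF discrete] TMaps[OF sets])
qed

end
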